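(* Let $(M,\nabla,g)$ be a trivial statistical manifold of constant curvature $k$. Let $(\tilde M,\tilde\nabla,\tilde g)$ be a statistical manifold of constant curvature $\tilde k$ such that the Riemannian manifold $(\tilde M,\tilde\nabla^{\circ},\tilde g)$, where $\tilde\nabla^{\circ}$ is the Levi-Civita connection of $\tilde g$, is of constant curvature $\stackrel{\circ}{\tilde k}$ with $\stackrel{\circ}{\tilde k}\neq\tilde k$. Let $f:M\rightarrow\tilde M$ be a statistical immersion of codimension one. Then $f$ is equiaffine, that is, $\tau^{*}$ vanishes.
   Context: A statistical manifold $(M,\nabla,g)$ is a smooth manifold $M$ with a Riemannian metric $g$ and a torsion-free affine connection $\nabla$ such that $(\nabla_{X}g)(Y,Z)=(\nabla_{Y}g)(X,Z)$ for all vector fields $X,Y,Z$ on $M$. It is trivial (Riemannian) if $\nabla$ is the Levi-Civita connection of $g$. It is of constant curvature $k\in\mathbf{R}$ if the curvature tensor $R$ of $\nabla$ satisfies $R(X,Y)Z=k\{g(Y,Z)X-g(X,Z)Y\}$ for all $X,Y,Z$ (the same definition applies to $(\tilde M,\tilde\nabla^{\circ},\tilde g)$). An immersion $f:M\to\tilde M$ between statistical manifolds $(M,\nabla,g)$ and $(\tilde M,\tilde\nabla,\tilde g)$ is a statistical immersion if $g=f^{*}\tilde g$ and $g(\nabla_{X}Y,Z)=\tilde g(\tilde\nabla_{X}f_{*}Y,f_{*}Z)$ for all vector fields $X,Y,Z$ on $M$. For $f$ of codimension one with unit normal vector field $\xi$, the bilinear form $h$, the $(1,1)$-tensor $A^{*}$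 and the $1$-form $\tau^{*}$ on $M$ are defined by $$\tilde\nabla_{X}f_{*}Y=f_{*}\nabla_{X}Y+h(X,Y)\xi,\qquad \tilde\nabla_{X}\xi=-f_{*}A^{*}X+\tau^{*}(X)\xi .$$
   Formalization: The formal theorem assumes dim M ≥ 2; for dim M = 1 the claim fails: give Euclidean R² the connection D+K with K(e1,e1)=e2, K(e1,e2)=e1+e2, K(e2,e2)=e1 (curvature −2 versus 0); the x-axis is then a statistical immersion with τ*(e1)=1. *)

theory Defs
  imports "HOL-Analysis.Analysis" "HOL-Library.Function_Algebras"
begin

text \<open>\<open>Ck_on k S f\<close> is meant for open \<open>S\<close>: all iterated directional derivatives of \<open>f\<close> up to
  order \<open>k\<close> exist (as Frechet derivatives) and are continuous on \<open>S\<close>.\<close>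

primrec Ck_on :: "nat \<Rightarrow> 'a::euclidean_space set \<Rightarrow> ('a \<Rightarrow> 'b::real_normed_vector) \<Rightarrow> bool" where
  "Ck_on 0 S f = continuous_on S f"
| "Ck_on (Suc k) S f =
     ((\<forall>x\<in>S. f differentiable (at x)) \<and>
      (\<forall>v. Ck_on k S (\<lambda>x. frechet_derivative f (at x) v)))"

definition smooth_on :: "'a::euclidean_space set \<Rightarrow> ('a \<Rightarrow> 'b::real_normed_vector) \<Rightarrow> bool" where
  "smooth_on S f \<longleftrightarrow> (\<forall>k. Ck_on k S f)"

text \<open>A chart is a pair of its domain and its coordinate map. The values of the coordinate map
  outside the domain are irrelevant. The model space is a Euclidean space, so the dimension of the
  manifold is \<open>DIM\<close> of the model type.\<close>

type_synonym ('m, 'e) chart = "'m set \<times> ('m \<Rightarrow> 'e)"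

abbreviation dom_chart :: "('m, 'e) chart \<Rightarrow> 'm set" where
  "dom_chart c \<equiv> fst c"

abbreviation crd :: "('m, 'e) chart \<Rightarrow> 'm \<Rightarrow> 'e" where
  "crd c \<equiv> snd c"

definition crd_inv :: "('m, 'e) chart \<Rightarrow> 'e \<Rightarrow> 'm" where
  "crd_inv c = the_inv_into (dom_chart c) (crd c)"

definition carrier_of :: "('m, 'e) chart set \<Rightarrow> 'm set" where
  "carrier_of A = (\<Union>c\<in>A. dom_chart c)"

text \<open>The manifold is the open subspace \<open>carrier_of A\<close> of a second countable Hausdorff space.
  The atlas \<open>A\<close> need not be maximal.\<close>

definition smooth_manifold ::
  "('m::{t2_space, second_countable_topology}, 'e::euclidean_space) chart set \<Rightarrow> bool" where
  "smooth_manifold A \<longleftrightarrow>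
     (\<forall>c\<in>A. open (dom_chart c) \<and> open (crd c ` dom_chart c) \<and>
        homeomorphism (dom_chart c) (crd c ` dom_chart c) (crd c) (crd_inv c)) \<and>
     (\<forall>c\<in>A. \<forall>d\<in>A.
        smooth_on (crd c ` (dom_chart c \<inter> dom_chart d)) (crd d \<circ> crd_inv c))"

definition smooth_fun ::
  "('m, 'e::euclidean_space) chart set \<Rightarrow> ('m \<Rightarrow> 'b::real_normed_vector) \<Rightarrow> bool" where
  "smooth_fun A h \<longleftrightarrow> (\<forall>c\<in>A. smooth_on (crd c ` dom_chart c) (h \<circ> crd_inv c))"

text \<open>A tangent vector at \<open>p\<close> is the family of its coordinate vectors in all the charts around \<open>p\<close>,
  transforming by the differentials of the coordinate changes. It is \<open>0\<close> on anything that is not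
  a chart around \<open>p\<close>, so that tangent vectors are determined as functions by their coordinates, and
  the only tangent vector at a point outside the carrier is \<open>0\<close>. Addition, subtraction and
  negation of tangent vectors and of vector fields are the pointwise operations on functions.\<close>

type_synonym ('m, 'e) tvec = "('m, 'e) chart \<Rightarrow> 'e"

type_synonym ('m, 'e) vfield = "'m \<Rightarrow> ('m, 'e) tvec"

definition tangent_space ::
  "('m, 'e::euclidean_space) chart set \<Rightarrow> 'm \<Rightarrow> ('m, 'e) tvec set" where
  "tangent_space A p = {v.
     (\<forall>c. \<not> (c \<in> A \<and> p \<in> dom_chart c) \<longrightarrow> v c = 0) \<and>
     (\<forall>c\<in>A. \<forall>d\<in>A. p \<in> dom_chart c \<and> p \<in> dom_chart d \<longrightarrow>
        v d = frechet_derivative (crd d \<circ> crd_inv c) (at (crd c p)) (v c))}"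

definition tscale :: "real \<Rightarrow> ('m, 'e::real_vector) tvec \<Rightarrow> ('m, 'e) tvec" where
  "tscale a v = (\<lambda>c. a *\<^sub>R v c)"

definition fscale :: "('m \<Rightarrow> real) \<Rightarrow> ('m, 'e::real_vector) vfield \<Rightarrow> ('m, 'e) vfield" where
  "fscale h X = (\<lambda>p. tscale (h p) (X p))"

definition vector_field ::
  "('m, 'e::euclidean_space) chart set \<Rightarrow> ('m, 'e) vfield \<Rightarrow> bool" where
  "vector_field A X \<longleftrightarrow>
     (\<forall>p. X p \<in> tangent_space A p) \<and>
     (\<forall>c\<in>A. smooth_on (crd c ` dom_chart c) (\<lambda>x. X (crd_inv c x) c))"

text \<open>The differential of \<open>u\<close> at \<open>p\<close> applied to the tangent vector \<open>v\<close>, for \<open>u\<close> defined and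
  differentiable near \<open>p\<close>; the result does not depend on the chart.\<close>

definition dirderiv ::
  "('m, 'e::euclidean_space) chart set \<Rightarrow> ('m \<Rightarrow> 'b::real_normed_vector) \<Rightarrow> 'm \<Rightarrow> ('m, 'e) tvec \<Rightarrow> 'b"
  where
  "dirderiv A u p v =
     (let c = (SOME c. c \<in> A \<and> p \<in> dom_chart c)
      in frechet_derivative (u \<circ> crd_inv c) (at (crd c p)) (v c))"

definition lie_bracket ::
  "('m, 'e::euclidean_space) chart set \<Rightarrow> ('m, 'e) vfield \<Rightarrow> ('m, 'e) vfield \<Rightarrow> ('m, 'e) vfield" where
  "lie_bracket A X Y = (\<lambda>p c. if c \<in> A \<and> p \<in> dom_chart c
      then dirderiv A (\<lambda>q. Y q c) p (X p) - dirderiv A (\<lambda>q. X q c) p (Y p) else 0)"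

type_synonym ('m, 'e) metric = "'m \<Rightarrow> ('m, 'e) tvec \<Rightarrow> ('m, 'e) tvec \<Rightarrow> real"

type_synonym ('m, 'e) connection = "('m, 'e) vfield \<Rightarrow> ('m, 'e) vfield \<Rightarrow> ('m, 'e) vfield"

definition riemannian_metric ::
  "('m, 'e::euclidean_space) chart set \<Rightarrow> ('m, 'e) metric \<Rightarrow> bool" where
  "riemannian_metric A g \<longleftrightarrow>
     (\<forall>p\<in>carrier_of A. \<forall>u\<in>tangent_space A p. \<forall>v\<in>tangent_space A p.
        (\<forall>w\<in>tangent_space A p. g p (u + v) w = g p u w + g p v w) \<and>
        (\<forall>a. g p (tscale a u) v = a * g p u v) \<and>
        g p u v = g p v u \<and>
        (u \<noteq> 0 \<longrightarrow> g p u u > 0)) \<and>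
     (\<forall>X Y. vector_field A X \<longrightarrow> vector_field A Y \<longrightarrow> smooth_fun A (\<lambda>p. g p (X p) (Y p)))"

text \<open>Real homogeneity in the second argument is the Leibniz rule for constant \<open>h\<close>. Only the values
  of a connection on smooth vector fields matter.\<close>

definition affine_connection ::
  "('m, 'e::euclidean_space) chart set \<Rightarrow> ('m, 'e) connection \<Rightarrow> bool" where
  "affine_connection A nabla \<longleftrightarrow>
     (\<forall>X Y. vector_field A X \<longrightarrow> vector_field A Y \<longrightarrow>
        vector_field A (nabla X Y) \<and>
        (\<forall>Z. vector_field A Z \<longrightarrow>
           nabla (X + Y) Z = nabla X Z + nabla Y Z \<and>
           nabla X (Y + Z) = nabla X Y + nabla X Z) \<and>
        (\<forall>h. smooth_fun A h \<longrightarrow>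
           nabla (fscale h X) Y = fscale h (nabla X Y) \<and>
           nabla X (fscale h Y) =
             fscale h (nabla X Y) + fscale (\<lambda>p. dirderiv A h p (X p)) Y))"

definition torsion_free ::
  "('m, 'e::euclidean_space) chart set \<Rightarrow> ('m, 'e) connection \<Rightarrow> bool" where
  "torsion_free A nabla \<longleftrightarrow>
     (\<forall>X Y. vector_field A X \<longrightarrow> vector_field A Y \<longrightarrow>
        nabla X Y - nabla Y X = lie_bracket A X Y)"

text \<open>\<open>(\<nabla>\<^sub>X g)(Y, Z) = X (g(Y, Z)) - g(\<nabla>\<^sub>X Y, Z) - g(Y, \<nabla>\<^sub>X Z)\<close>\<close>

definition cov_metric ::
  "('m, 'e::euclidean_space) chart set \<Rightarrow> ('m, 'e) connection \<Rightarrow> ('m, 'e) metric \<Rightarrow>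
   ('m, 'e) vfield \<Rightarrow> ('m, 'e) vfield \<Rightarrow> ('m, 'e) vfield \<Rightarrow> 'm \<Rightarrow> real" where
  "cov_metric A nabla g X Y Z p =
     dirderiv A (\<lambda>q. g q (Y q) (Z q)) p (X p) - g p (nabla X Y p) (Z p) - g p (Y p) (nabla X Z p)"

definition statistical_manifold ::
  "('m::{t2_space, second_countable_topology}, 'e::euclidean_space) chart set \<Rightarrow>
   ('m, 'e) connection \<Rightarrow> ('m, 'e) metric \<Rightarrow> bool" where
  "statistical_manifold A nabla g \<longleftrightarrow>
     smooth_manifold A \<and> riemannian_metric A g \<and> affine_connection A nabla \<and> torsion_free A nabla \<and>
     (\<forall>X Y Z. vector_field A X \<longrightarrow> vector_field A Y \<longrightarrow> vector_field A Z \<longrightarrow>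
        (\<forall>p\<in>carrier_of A. cov_metric A nabla g X Y Z p = cov_metric A nabla g Y X Z p))"

definition levi_civita ::
  "('m, 'e::euclidean_space) chart set \<Rightarrow> ('m, 'e) connection \<Rightarrow> ('m, 'e) metric \<Rightarrow> bool" where
  "levi_civita A nabla g \<longleftrightarrow>
     affine_connection A nabla \<and> torsion_free A nabla \<and>
     (\<forall>X Y Z. vector_field A X \<longrightarrow> vector_field A Y \<longrightarrow> vector_field A Z \<longrightarrow>
        (\<forall>p\<in>carrier_of A. cov_metric A nabla g X Y Z p = 0))"

definition trivial_statistical_manifold ::
  "('m::{t2_space, second_countable_topology}, 'e::euclidean_space) chart set \<Rightarrow>
   ('m, 'e) connection \<Rightarrow> ('m, 'e) metric \<Rightarrow> bool" where
  "trivial_statistical_manifold A nabla g \<longleftrightarrow>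
     statistical_manifold A nabla g \<and> levi_civita A nabla g"

definition curvature ::
  "('m, 'e::euclidean_space) chart set \<Rightarrow> ('m, 'e) connection \<Rightarrow>
   ('m, 'e) vfield \<Rightarrow> ('m, 'e) vfield \<Rightarrow> ('m, 'e) vfield \<Rightarrow> ('m, 'e) vfield" where
  "curvature A nabla X Y Z =
     nabla X (nabla Y Z) - nabla Y (nabla X Z) - nabla (lie_bracket A X Y) Z"

definition constant_curvature ::
  "('m, 'e::euclidean_space) chart set \<Rightarrow> ('m, 'e) connection \<Rightarrow> ('m, 'e) metric \<Rightarrow> real \<Rightarrow> bool" where
  "constant_curvature A nabla g k \<longleftrightarrow>
     (\<forall>X Y Z. vector_field A X \<longrightarrow> vector_field A Y \<longrightarrow> vector_field A Z \<longrightarrow>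
        curvature A nabla X Y Z =
          fscale (\<lambda>p. k) (fscale (\<lambda>p. g p (Y p) (Z p)) X - fscale (\<lambda>p. g p (X p) (Z p)) Y))"

definition smooth_map ::
  "('m::topological_space, 'e::euclidean_space) chart set \<Rightarrow>
   ('n::topological_space, 'f::euclidean_space) chart set \<Rightarrow> ('m \<Rightarrow> 'n) \<Rightarrow> bool" where
  "smooth_map A B f \<longleftrightarrow>
     f ` carrier_of A \<subseteq> carrier_of B \<and> continuous_on (carrier_of A) f \<and>
     (\<forall>c\<in>A. \<forall>d\<in>B.
        smooth_on (crd c ` (dom_chart c \<inter> f -` dom_chart d)) (crd d \<circ> f \<circ> crd_inv c))"

definition pushforward ::
  "('m, 'e::euclidean_space) chart set \<Rightarrow> ('n, 'f::euclidean_space) chart set \<Rightarrow> ('m \<Rightarrow> 'n) \<Rightarrow>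
   'm \<Rightarrow> ('m, 'e) tvec \<Rightarrow> ('n, 'f) tvec" where
  "pushforward A B f p v = (\<lambda>d. if d \<in> B \<and> f p \<in> dom_chart d then dirderiv A (crd d \<circ> f) p v else 0)"

definition immersion ::
  "('m::topological_space, 'e::euclidean_space) chart set \<Rightarrow>
   ('n::topological_space, 'f::euclidean_space) chart set \<Rightarrow> ('m \<Rightarrow> 'n) \<Rightarrow> bool" where
  "immersion A B f \<longleftrightarrow> smooth_map A B f \<and>
     (\<forall>p\<in>carrier_of A. inj_on (pushforward A B f p) (tangent_space A p))"

definition section_along ::
  "('m, 'e::euclidean_space) chart set \<Rightarrow> ('n, 'f::euclidean_space) chart set \<Rightarrow> ('m \<Rightarrow> 'n) \<Rightarrow>
   'm set \<Rightarrow> ('m \<Rightarrow> ('n, 'f) tvec) \<Rightarrow> bool" where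
  "section_along A B f U V \<longleftrightarrow>
     (\<forall>p\<in>U. V p \<in> tangent_space B (f p)) \<and>
     (\<forall>c\<in>A. \<forall>d\<in>B.
        smooth_on (crd c ` (dom_chart c \<inter> U \<inter> f -` dom_chart d)) (\<lambda>x. V (crd_inv c x) d))"

text \<open>\<open>christoffel B nabla d q a b\<close> is the coordinate vector in the chart \<open>d\<close> of \<open>\<nabla>\<^sub>X Y\<close> at \<open>q\<close>, where
  \<open>X\<close>, \<open>Y\<close> are global vector fields such that \<open>X\<close> has coordinates \<open>a\<close> at \<open>q\<close> and \<open>Y\<close> has constant
  coordinates \<open>b\<close> near \<open>q\<close>. Such fields exist, and the result does not depend on their choice; for
  basis vectors \<open>a\<close>, \<open>b\<close> its components are the Christoffel symbols of \<open>nabla\<close> in \<open>d\<close>.\<close>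

definition christoffel ::
  "('n::topological_space, 'f::euclidean_space) chart set \<Rightarrow> ('n, 'f) connection \<Rightarrow>
   ('n, 'f) chart \<Rightarrow> 'n \<Rightarrow> 'f \<Rightarrow> 'f \<Rightarrow> 'f" where
  "christoffel B nabla d q a b =
     nabla (SOME X. vector_field B X \<and> X q d = a)
           (SOME Y. vector_field B Y \<and> (\<exists>N. open N \<and> q \<in> N \<and> N \<subseteq> dom_chart d \<and> (\<forall>r\<in>N. Y r d = b)))
           q d"

text \<open>The covariant derivative \<open>\<nabla>\<^sub>v V\<close> at \<open>p\<close> of a section \<open>V\<close> along \<open>f\<close> defined near \<open>p\<close>, for a
  connection \<open>nabla\<close> on the target of \<open>f\<close>. In local coordinates this is
  \<open>dV(v) + \<Gamma>(f\<^sub>* v, V)\<close>.\<close>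

definition cov_along ::
  "('m, 'e::euclidean_space) chart set \<Rightarrow> ('n::topological_space, 'f::euclidean_space) chart set \<Rightarrow>
   ('n, 'f) connection \<Rightarrow> ('m \<Rightarrow> 'n) \<Rightarrow> ('m \<Rightarrow> ('n, 'f) tvec) \<Rightarrow> 'm \<Rightarrow> ('m, 'e) tvec \<Rightarrow> ('n, 'f) tvec" where
  "cov_along A B nabla f V p v = (\<lambda>d. if d \<in> B \<and> f p \<in> dom_chart d
      then dirderiv A (\<lambda>q. V q d) p v + christoffel B nabla d (f p) (pushforward A B f p v d) (V p d)
      else 0)"

definition statistical_immersion ::
  "('m::topological_space, 'e::euclidean_space) chart set \<Rightarrow> ('m, 'e) connection \<Rightarrow> ('m, 'e) metric \<Rightarrow>
   ('n::topological_space, 'f::euclidean_space) chart set \<Rightarrow> ('n, 'f) connection \<Rightarrow> ('n, 'f) metric \<Rightarrow>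
   ('m \<Rightarrow> 'n) \<Rightarrow> bool" where
  "statistical_immersion A nabla g B nabla' g' f \<longleftrightarrow>
     immersion A B f \<and>
     (\<forall>p\<in>carrier_of A. \<forall>u\<in>tangent_space A p. \<forall>v\<in>tangent_space A p.
        g p u v = g' (f p) (pushforward A B f p u) (pushforward A B f p v)) \<and>
     (\<forall>X Y Z. vector_field A X \<longrightarrow> vector_field A Y \<longrightarrow> vector_field A Z \<longrightarrow>
        (\<forall>p\<in>carrier_of A.
           g p (nabla X Y p) (Z p) =
           g' (f p) (cov_along A B nabla' f (\<lambda>q. pushforward A B f q (Y q)) p (X p))
                    (pushforward A B f p (Z p))))"

definition unit_normal_on ::
  "('m, 'e::euclidean_space) chart set \<Rightarrow> ('n, 'f::euclidean_space) chart set \<Rightarrow> ('n, 'f) metric \<Rightarrow>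
   ('m \<Rightarrow> 'n) \<Rightarrow> 'm set \<Rightarrow> ('m \<Rightarrow> ('n, 'f) tvec) \<Rightarrow> bool" where
  "unit_normal_on A B g' f U \<xi> \<longleftrightarrow>
     section_along A B f U \<xi> \<and>
     (\<forall>p\<in>U. g' (f p) (\<xi> p) (\<xi> p) = 1 \<and>
        (\<forall>u\<in>tangent_space A p. g' (f p) (\<xi> p) (pushforward A B f p u) = 0))"

text \<open>The number \<open>\<tau>\<^sup>*(v)\<close> in the decomposition \<open>\<nabla>\<^sub>v \<xi> = - f\<^sub>* (A\<^sup>* v) + \<tau>\<^sup>*(v) \<xi>\<close> of the covariant
  derivative at \<open>p\<close> in its tangential and normal parts; \<open>w\<close> is \<open>A\<^sup>* v\<close>.\<close>

definition tau_star ::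
  "('m, 'e::euclidean_space) chart set \<Rightarrow> ('n::topological_space, 'f::euclidean_space) chart set \<Rightarrow>
   ('n, 'f) connection \<Rightarrow> ('m \<Rightarrow> 'n) \<Rightarrow> ('m \<Rightarrow> ('n, 'f) tvec) \<Rightarrow> 'm \<Rightarrow> ('m, 'e) tvec \<Rightarrow> real" where
  "tau_star A B nabla' f \<xi> p v =
     (THE t. \<exists>w\<in>tangent_space A p.
        cov_along A B nabla' f \<xi> p v = - pushforward A B f p w + tscale t (\<xi> p))"

text \<open>A unit normal field need only exist locally, and changing its sign does not affect \<open>\<tau>\<^sup>*\<close>.
  Hence \<open>\<tau>\<^sup>*\<close> is required to vanish for all local unit normal fields; this includes the global
  ones (\<open>U = carrier_of A\<close>), if there are any.\<close>

definition equiaffine ::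
  "('m::topological_space, 'e::euclidean_space) chart set \<Rightarrow>
   ('n::topological_space, 'f::euclidean_space) chart set \<Rightarrow>
   ('n, 'f) connection \<Rightarrow> ('n, 'f) metric \<Rightarrow> ('m \<Rightarrow> 'n) \<Rightarrow> bool" where
  "equiaffine A B nabla' g' f \<longleftrightarrow>
     (\<forall>U \<xi>. open U \<longrightarrow> U \<subseteq> carrier_of A \<longrightarrow> unit_normal_on A B g' f U \<xi> \<longrightarrow>
        (\<forall>p\<in>U. \<forall>v\<in>tangent_space A p. tau_star A B nabla' f \<xi> p v = 0))"

end

theory Submission
  imports Defs
begin

text \<open>
  Let \<open>K = \<nabla>' - \<nabla>0'\<close> be the difference between the connection of the ambient statistical manifold
  and the Levi-Civita connection of its metric. The Codazzi equation says that the cubic form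
  \<open>C(X, Y, Z) = g'(K\<^sub>X Y, Z)\<close> is totally symmetric (\<open>K_symmetric\<close>). The theorem is a pointwise
  statement about \<open>C\<close> that rests on three facts.

  \<^item> If both connections have constant curvature, then
    \<open>[K\<^sub>X, K\<^sub>Y] Z = (k' - k0') (g'(Y, Z) X - g'(X, Z) Y)\<close>: the difference of the curvatures consists of
    this commutator and of a derivative of \<open>K\<close>, and the two are told apart by being skew
    and symmetric endomorphisms (\<open>K_commutator\<close>).

  \<^item> \<open>C\<close> vanishes on tangential vectors, because \<open>\<nabla>'\<close> and \<open>\<nabla>0'\<close> both induce metric connections on the
    trivial statistical manifold \<open>M\<close> (\<open>K_tangential\<close>).

  \<^item> \<open>\<tau>\<^sup>*(v) = C(f\<^sub>* v, \<xi>, \<xi>)\<close>, because the derivative of a unit normal field for the Levi-Civita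
    connection is tangential (\<open>tau_star_eq\<close>).

  By the second fact \<open>K\<close> maps pairs of tangential vectors to multiples \<open>a(x, y) \<xi>\<close> of the normal. The
  normal part of the first fact reads \<open>a(y, z) \<tau>\<^sup>*(x) = a(x, z) \<tau>\<^sup>*(y)\<close>, and its tangential part is
  \<open>a(y, z) a(x, w) - a(x, z) a(y, w) = (k' - k0') (g'(y, z) g'(x, w) - g'(x, z) g'(y, w))\<close>. If
  \<open>\<tau>\<^sup>*\<close> were not zero, the first equation would force \<open>a\<close> to have rank at most \<open>1\<close>, so the
  left-hand side of the second would vanish, which is impossible in dimension at least \<open>2\<close> when
  \<open>k' \<noteq> k0'\<close> (\<open>normal_cubic_form_0\<close>).

  The remaining work is to make these calculations available. Connections act on global vector
  fields, and covariant derivatives along \<open>f\<close> are given by Christoffel symbols, so one needs smooth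
  cutoff functions to extend tangent vectors and coordinate frames to global fields
  (\<open>cutoff_exists\<close>, \<open>frame_exists\<close>), the locality of connections (\<open>nabla_local_formula\<close>), the
  expression of the derivative along \<open>f\<close> in a frame of global fields (\<open>cov_along_frame\<close>), and its
  compatibility with the metric (\<open>compatible_along\<close>).
\<close>

section \<open>Calculus of iterated differentiability\<close>

lemma Ck_on_subset: "Ck_on k S f \<Longrightarrow> T \<subseteq> S \<Longrightarrow> Ck_on k T f"
  by (induction k arbitrary: f) (auto intro: continuous_on_subset)

lemma Ck_on_Suc_imp_continuous: "Ck_on (Suc k) S f \<Longrightarrow> continuous_on S f"
  by (auto intro!: continuous_at_imp_continuous_on differentiable_imp_continuous_within)

lemma Ck_on_Suc_imp: "Ck_on (Suc k) S f \<Longrightarrow> Ck_on k S f"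
proof (induction k arbitrary: f)
  case 0
  then show ?case using Ck_on_Suc_imp_continuous[of 0 S f] by simp
qed auto

text \<open>The directional derivatives in \<open>Ck_on\<close> are two-sided, so they see \<open>f\<close> only through its values
  near each point of the open set \<open>S\<close>. The next two lemmas turn this into the patching argument by
  which functions on manifolds are shown to be smooth chart by chart.\<close>

lemma Ck_on_cong:
  assumes "open S" "\<And>x. x \<in> S \<Longrightarrow> f x = g x" "Ck_on k S f"
  shows "Ck_on k S g"
  using assms(2,3)
proof (induction k arbitrary: f g)
  case 0
  then show ?case using continuous_on_cong[of S S f g] by simp
next
  case (Suc k)
  have d: "f differentiable (at x)" if "x \<in> S" for x using Suc.prems(2) that by simp
  have "g differentiable (at x)" if "x \<in> S" for x
    using d[OF that] that assms(1) Suc.prems(1)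
    by (meson differentiable_def has_derivative_transform_within_open)
  moreover have "Ck_on k S (\<lambda>x. frechet_derivative g (at x) v)" for v
  proof (rule Suc.IH)
    show "Ck_on k S (\<lambda>x. frechet_derivative f (at x) v)" using Suc.prems(2) by simp
    show "frechet_derivative f (at x) v = frechet_derivative g (at x) v" if "x \<in> S" for x
      using frechet_derivative_transform_within_open[OF d[OF that] assms(1) that] Suc.prems(1)
      by simp
  qed
  ultimately show ?case by simp
qed

lemma Ck_on_local:
  assumes "\<And>x. x \<in> S \<Longrightarrow> \<exists>U. open U \<and> x \<in> U \<and> Ck_on k U f"
  shows "Ck_on k S f"
  using assms
proof (induction k arbitrary: f)
  case 0
  then have "isCont f x" if "x \<in> S" for x
    using that continuous_on_eq_continuous_at by fastforce
  then show ?case by (simp add: continuous_at_imp_continuous_on)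
next
  case (Suc k)
  have "Ck_on k S (\<lambda>x. frechet_derivative f (at x) v)" for v
    by (rule Suc.IH) (use Suc.prems in fastforce)
  moreover have "f differentiable (at x)" if "x \<in> S" for x
    using Suc.prems[OF that] by auto
  ultimately show ?case by simp
qed

text \<open>\<open>Ck_on\<close> refers to \<open>frechet_derivative\<close>, a choice operator. This form of the recursion step lets
  the derivative be any expression that the differentiation rules produce.\<close>

lemma Ck_on_SucI:
  assumes "open S" "\<And>x. x \<in> S \<Longrightarrow> (f has_derivative f' x) (at x)"
    and "\<And>v. Ck_on k S (\<lambda>x. f' x v)"
  shows "Ck_on (Suc k) S f"
proof -
  have "Ck_on k S (\<lambda>x. frechet_derivative f (at x) v)" for v
    by (rule Ck_on_cong[OF assms(1) _ assms(3)[of v]])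
      (metis assms(2) frechet_derivative_at)
  then show ?thesis using assms(2) by (auto intro: differentiableI)
qed

lemma Ck_on_SucD:
  assumes "Ck_on (Suc k) S f"
  shows "\<And>x. x \<in> S \<Longrightarrow> (f has_derivative frechet_derivative f (at x)) (at x)"
    and "\<And>v. Ck_on k S (\<lambda>x. frechet_derivative f (at x) v)"
  using assms by (auto simp: frechet_derivative_works)

lemma Ck_on_const: "Ck_on k S (\<lambda>x. c)"
  by (induction k arbitrary: c) auto

lemma Ck_on_bounded_linear:
  assumes "open S" "bounded_linear L" "Ck_on k S f"
  shows "Ck_on k S (\<lambda>x. L (f x))"
  using assms(3)
proof (induction k arbitrary: f)
  case 0
  then show ?case
    using bounded_linear.continuous_on[OF assms(2)] by simp
next
  case (Suc k)
  note D = Ck_on_SucD[OF Suc.prems]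
  show ?case
    by (rule Ck_on_SucI[OF assms(1)])
      (use D Suc.IH in \<open>auto intro: bounded_linear.has_derivative[OF assms(2)]\<close>)
qed

lemma Ck_on_add:
  assumes "open S" "Ck_on k S f" "Ck_on k S g"
  shows "Ck_on k S (\<lambda>x. f x + g x)"
  using assms(2,3)
proof (induction k arbitrary: f g)
  case 0
  then show ?case by (simp add: continuous_on_add)
next
  case (Suc k)
  note D = Ck_on_SucD[OF Suc.prems(1)] Ck_on_SucD[OF Suc.prems(2)]
  show ?case
    by (rule Ck_on_SucI[OF assms(1)]) (use D Suc.IH in \<open>auto intro: has_derivative_add\<close>)
qed

lemma Ck_on_sum:
  assumes "open S" "\<And>i. i \<in> I \<Longrightarrow> Ck_on k S (f i)"
  shows "Ck_on k S (\<lambda>x. \<Sum>i\<in>I. f i x)"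
  using assms(2)
  by (induction I rule: infinite_finite_induct) (auto intro: Ck_on_add Ck_on_const assms(1))

lemma Ck_on_bilinear:
  assumes "open S" "bounded_bilinear pr" "Ck_on k S f" "Ck_on k S g"
  shows "Ck_on k S (\<lambda>x. pr (f x) (g x))"
  using assms(3,4)
proof (induction k arbitrary: f g)
  case 0
  then show ?case using bounded_bilinear.continuous_on[OF assms(2)] by simp
next
  case (Suc k)
  note D = Ck_on_SucD[OF Suc.prems(1)] Ck_on_SucD[OF Suc.prems(2)]
  show ?case
  proof (rule Ck_on_SucI[OF assms(1) bounded_bilinear.FDERIV[OF assms(2) D(1) D(3)]])
    fix v
    show "Ck_on k S (\<lambda>x. pr (f x) (frechet_derivative g (at x) v)
        + pr (frechet_derivative f (at x) v) (g x))"
      by (intro Ck_on_add assms(1) Suc.IH D Ck_on_Suc_imp[OF Suc.prems(1)]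
        Ck_on_Suc_imp[OF Suc.prems(2)])
  qed (use D in blast)+
qed

lemmas Ck_on_scaleR = Ck_on_bilinear[OF _ bounded_bilinear_scaleR]
lemmas Ck_on_mult = Ck_on_bilinear[OF _ bounded_bilinear_mult]
lemmas Ck_on_inner = Ck_on_bounded_linear[OF _ bounded_linear_inner_left]

text \<open>The derivative \<open>g'(f x) (f' x v)\<close> does not have the form of a directional derivative of \<open>g\<close> in a
  fixed direction. Expanding \<open>f' x v\<close> in the standard basis gives a finite sum of products of scalar
  functions with \<open>g'(f x) i\<close> for fixed basis vectors \<open>i\<close>, to which the induction hypothesis applies.\<close>

lemma Ck_on_compose:
  fixes f :: "'a::euclidean_space \<Rightarrow> 'b::euclidean_space"
  assumes "open S" "open T" "f ` S \<subseteq> T" "Ck_on k S f" "Ck_on k T g"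
  shows "Ck_on k S (\<lambda>x. g (f x))"
  using assms(4,5)
proof (induction k arbitrary: g)
  case 0
  then show ?case using assms(3) by (simp add: continuous_on_compose2)
next
  case (Suc k)
  note D = Ck_on_SucD[OF Suc.prems(1)] Ck_on_SucD[OF Suc.prems(2)]
  let ?f' = "\<lambda>x. frechet_derivative f (at x)" and ?g' = "\<lambda>y. frechet_derivative g (at y)"
  show ?case
  proof (rule Ck_on_SucI[OF assms(1)])
    fix x assume "x \<in> S"
    then have fx: "(f has_derivative ?f' x) (at x)"
      and gx: "(g has_derivative ?g' (f x)) (at (f x))"
      using D assms(3) by auto
    from diff_chain_at[OF this] 
    have c: "((\<lambda>x. g (f x)) has_derivative (\<lambda>v. ?g' (f x) (?f' x v))) (at x)"
      by (simp add: o_def)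
    have "?g' (f x) (?f' x v) = (\<Sum>i\<in>Basis. (?f' x v \<bullet> i) *\<^sub>R ?g' (f x) i)" for v
    proof -
      have "?g' (f x) (?f' x v) = ?g' (f x) (\<Sum>i\<in>Basis. (?f' x v \<bullet> i) *\<^sub>R i)"
        by (simp add: euclidean_representation)
      also have "\<dots> = (\<Sum>i\<in>Basis. (?f' x v \<bullet> i) *\<^sub>R ?g' (f x) i)"
        using has_derivative_linear[OF gx] by (simp add: linear_sum linear_scale)
      finally show ?thesis .
    qed
    with c show "((\<lambda>x. g (f x)) has_derivative
        (\<lambda>v. \<Sum>i\<in>Basis. (?f' x v \<bullet> i) *\<^sub>R ?g' (f x) i)) (at x)"
      by simp
  next
    fix v
    have "Ck_on k S (\<lambda>x. ?g' (f x) i)" for i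
      by (rule Suc.IH[OF Ck_on_Suc_imp[OF Suc.prems(1)] D(4)])
    then show "Ck_on k S (\<lambda>x. \<Sum>i\<in>Basis. (?f' x v \<bullet> i) *\<^sub>R ?g' (f x) i)"
      by (intro Ck_on_sum Ck_on_scaleR Ck_on_inner assms(1) D)
  qed
qed

lemma Ck_on_inverse: "Ck_on k {0<..} (inverse :: real \<Rightarrow> real)"
proof (induction k)
  case 0
  then show ?case by (auto intro!: continuous_intros)
next
  case (Suc k)
  show ?case
  proof (rule Ck_on_SucI)
    show "(inverse has_derivative (\<lambda>h. - (inverse x * h * inverse x))) (at x)"
      if "x \<in> {0<..}" for x :: real
      using that by (auto intro!: has_derivative_inverse')
    show "Ck_on k {0<..} (\<lambda>x::real. - (inverse x * v * inverse x))" for v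
      by (intro Ck_on_bounded_linear[of _ uminus] Ck_on_mult Suc Ck_on_const
          bounded_linear_minus bounded_linear_ident) auto
  qed auto
qed

section \<open>Smooth cutoff functions on Euclidean space\<close>

text \<open>The factor \<open>1 / t ^ m\<close> makes the linear span of the family closed under differentiation, so that
  smoothness of all members follows by a single induction.\<close>

definition flat_exp :: "nat \<Rightarrow> real \<Rightarrow> real" where
  "flat_exp m t = (if t > 0 then exp (- 1 / t) / t ^ m else 0)"

text \<open>At \<open>0\<close> the difference quotient from the right is again of the form
  \<open>exp (- 1 / h) / h ^ n\<close>, and it tends to \<open>0\<close> because \<open>exp\<close> grows faster than every power.\<close>

lemma flat_exp_has_derivative:
  "(flat_exp m has_real_derivative (flat_exp (m + 2) t - m * flat_exp (m + 1) t)) (at t)"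
proof (cases t "0::real" rule: linorder_cases)
  case less
  have "((\<lambda>t. 0) has_real_derivative 0) (at t)" by simp
  then show ?thesis
    using less has_field_derivative_transform_within_open[of "\<lambda>t. 0" 0 t "{..<0}" "flat_exp m"]
    by (simp add: flat_exp_def)
next
  case greater
  have "((\<lambda>t. exp (- 1 / t) / t ^ m) has_real_derivative
      exp (- 1 / t) / t ^ (m + 2) - m * (exp (- 1 / t) / t ^ (m + 1))) (at t)"
  proof -
    have "((\<lambda>t. exp (- inverse t) * inverse t ^ m) has_real_derivative
        exp (- inverse t) * (inverse t * inverse t) * inverse t ^ m
        + m * (inverse t ^ (m - 1) * (- (inverse t * inverse t))) * exp (- inverse t)) (at t)"
      using greater by (auto intro!: derivative_eq_intros)
    moreover have "exp (- inverse t) * (inverse t * inverse t) * inverse t ^ m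
        + m * (inverse t ^ (m - 1) * (- (inverse t * inverse t))) * exp (- inverse t)
        = exp (- 1 / t) / t ^ (m + 2) - m * (exp (- 1 / t) / t ^ (m + 1))"
      by (cases m) (simp_all add: divide_inverse power_inverse algebra_simps)
    moreover have "(\<lambda>t::real. exp (- inverse t) * inverse t ^ m) = (\<lambda>t. exp (- 1 / t) / t ^ m)"
      by (simp add: inverse_eq_divide power_one_over)
    ultimately show ?thesis by metis
  qed
  from has_field_derivative_transform_within_open[OF this, of "{0<..}" "flat_exp m"]
  show ?thesis using greater by (simp add: flat_exp_def)
next
  case equal
  have "((\<lambda>h::real. exp (- 1 / h) / h ^ m / h) \<longlongrightarrow> 0) (at_right 0)"
  proof -
    have "((\<lambda>h. inverse h ^ (m + 1) / exp (inverse h)) \<longlongrightarrow> (0::real)) (at_right 0)"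
      by (rule filterlim_compose[OF tendsto_power_div_exp_0 filterlim_inverse_at_top_right])
    moreover have "inverse h ^ (m + 1) / exp (inverse h) = exp (- 1 / h) / h ^ m / h" for h :: real
      by (simp add: exp_minus inverse_eq_divide power_one_over mult_ac)
    ultimately show ?thesis by (simp only:)
  qed
  then have "((\<lambda>h. flat_exp m h / h) \<longlongrightarrow> 0) (at_right 0)"
    by (rule Lim_transform_eventually) (auto simp: eventually_at_filter flat_exp_def)
  moreover have "((\<lambda>h. flat_exp m h / h) \<longlongrightarrow> 0) (at_left 0)"
    by (rule tendsto_eventually) (auto simp: eventually_at_filter flat_exp_def)
  ultimately have "((\<lambda>h. flat_exp m h / h) \<longlongrightarrow> 0) (at 0)"
    by (simp add: filterlim_split_at)
  then show ?thesis
    using equal by (simp add: has_field_derivative_iff flat_exp_def[of _ 0])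
qed

lemma Ck_on_flat_exp: "Ck_on k UNIV (flat_exp m)"
proof (induction k arbitrary: m)
  case 0
  then show ?case
    using flat_exp_has_derivative by (auto intro!: continuous_at_imp_continuous_on DERIV_isCont)
next
  case (Suc k)
  show ?case
  proof (rule Ck_on_SucI)
    fix t :: real
    show "(flat_exp m has_derivative
        (\<lambda>v. v * flat_exp (m + 2) t + (v * (- real m)) * flat_exp (m + 1) t)) (at t)"
      using flat_exp_has_derivative[of m t, THEN has_field_derivative_imp_has_derivative]
      by (rule has_derivative_eq_rhs) (simp add: fun_eq_iff algebra_simps)
  next
    fix v :: real
    show "Ck_on k UNIV
        (\<lambda>t. v * flat_exp (m + 2) t + (v * (- real m)) * flat_exp (m + 1) t)"
      by (intro Ck_on_add Ck_on_mult Ck_on_const Suc open_UNIV)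
  qed auto
qed

text \<open>With \<open>s\<close> the squared distance from \<open>x0\<close>, the function is \<open>u / (u + w)\<close>, where \<open>u\<close> vanishes exactly
  for \<open>s \<ge> r\<^sup>2\<close> and \<open>w\<close> exactly for \<open>s \<le> (r / 2)\<^sup>2\<close>; the denominator has no zero.\<close>

lemma smooth_bump:
  fixes x0 :: "'a::euclidean_space"
  assumes "r > 0"
  obtains h :: "'a \<Rightarrow> real" where
    "smooth_on UNIV h" "\<And>x. x \<in> ball x0 (r / 2) \<Longrightarrow> h x = 1" "\<And>x. x \<notin> ball x0 r \<Longrightarrow> h x = 0"
proof -
  define s where "s x = (x - x0) \<bullet> (x - x0)" for x
  define u where "u x = flat_exp 0 (r\<^sup>2 - s x)" for x
  define w where "w x = flat_exp 0 (s x - (r / 2)\<^sup>2)" for x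
  have s: "s x = (dist x0 x)\<^sup>2" for x
    by (simp add: s_def dist_norm norm_minus_commute[of x0] power2_norm_eq_inner)
  have pos: "u x + w x > 0" for x
  proof (cases "s x < r\<^sup>2")
    case False
    have "(r/2)\<^sup>2 < r\<^sup>2" using assms by (simp add: power2_eq_square)
    with False show ?thesis by (simp add: u_def w_def flat_exp_def)
  qed (auto simp: u_def w_def flat_exp_def intro!: add_pos_nonneg)
  have id: "Ck_on k UNIV (\<lambda>x::'a. x)" for k
    by (cases k) (auto intro!: Ck_on_const continuous_intros)
  have ss: "Ck_on k UNIV s" for k
  proof -
    have "Ck_on k UNIV (\<lambda>x. x + (- x0))"
      by (intro Ck_on_add id Ck_on_const open_UNIV)
    then show ?thesis
      unfolding s_def by (intro Ck_on_bilinear[OF _ bounded_bilinear_inner]) auto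
  qed
  have "Ck_on k UNIV (\<lambda>x. r\<^sup>2 + (- 1) * s x)" for k
    by (intro Ck_on_add Ck_on_mult Ck_on_const ss open_UNIV)
  from Ck_on_compose[OF open_UNIV open_UNIV subset_UNIV this Ck_on_flat_exp[of _ 0]]
  have u: "Ck_on k UNIV u" for k
    by (simp add: u_def[abs_def])
  have "Ck_on k UNIV (\<lambda>x. s x + (- (r / 2)\<^sup>2))" for k
    by (intro Ck_on_add Ck_on_mult Ck_on_const ss open_UNIV)
  from Ck_on_compose[OF open_UNIV open_UNIV subset_UNIV this Ck_on_flat_exp[of _ 0]]
  have w: "Ck_on k UNIV w" for k
    by (simp add: w_def[abs_def])
  have "Ck_on k UNIV (\<lambda>x. inverse (u x + w x))" for k
    by (rule Ck_on_compose[OF _ _ _ Ck_on_add[OF _ u w] Ck_on_inverse]) (use pos in auto)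
  then have "Ck_on k UNIV (\<lambda>x. u x * inverse (u x + w x))" for k
    by (intro Ck_on_mult u) auto
  then have "smooth_on UNIV (\<lambda>x. u x * inverse (u x + w x))"
    by (simp add: smooth_on_def)
  moreover have "u x * inverse (u x + w x) = 1" if "x \<in> ball x0 (r / 2)" for x
  proof -
    have "s x \<le> (r / 2)\<^sup>2" unfolding s using that by (auto intro!: power_mono)
    then have "w x = 0" by (simp add: w_def flat_exp_def)
    with pos[of x] show ?thesis by simp
  qed
  moreover have "u x * inverse (u x + w x) = 0" if "x \<notin> ball x0 r" for x
  proof -
    have "r\<^sup>2 \<le> s x" unfolding s using that assms by (auto intro!: power_mono)
    then show ?thesis by (simp add: u_def flat_exp_def)
  qed
  ultimately show thesis using that by blast
qed

section \<open>Charts and tangent spaces\<close>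

text \<open>The tangent vector at \<open>p\<close> with coordinates \<open>a\<close> in the chart \<open>c\<close>.\<close>

definition tvec_of :: "('m, 'e::euclidean_space) chart set \<Rightarrow> ('m, 'e) chart \<Rightarrow> 'm \<Rightarrow> 'e \<Rightarrow> ('m, 'e) tvec"
  where "tvec_of A c p a = (\<lambda>d. if d \<in> A \<and> p \<in> dom_chart d
    then frechet_derivative (crd d \<circ> crd_inv c) (at (crd c p)) a else 0)"

definition differentiable_pt :: "('m, 'e::euclidean_space) chart set \<Rightarrow> ('m \<Rightarrow> 'b::real_normed_vector) \<Rightarrow> 'm \<Rightarrow> bool"
  where "differentiable_pt A u p \<longleftrightarrow>
    (\<forall>c\<in>A. p \<in> dom_chart c \<longrightarrow> (u \<circ> crd_inv c) differentiable (at (crd c p)))"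

text \<open>Besides differentiability this fixes \<open>D\<close> only on the tangent space. Stating the differentiation
  rules for this relation keeps the side conditions of \<open>dirderiv\<close> out of the calculations, as
  \<open>has_derivative\<close> does on normed spaces.\<close>

definition has_dirderiv :: "('m, 'e::euclidean_space) chart set \<Rightarrow> 'm \<Rightarrow> ('m \<Rightarrow> 'b::real_normed_vector) \<Rightarrow>
    (('m, 'e) tvec \<Rightarrow> 'b) \<Rightarrow> bool"
  where "has_dirderiv A p u D \<longleftrightarrow>
    differentiable_pt A u p \<and> (\<forall>v\<in>tangent_space A p. dirderiv A u p v = D v)"

lemma has_dirderiv_differentiable_pt: "differentiable_pt A u p \<Longrightarrow> has_dirderiv A p u (dirderiv A u p)"
  by (simp add: has_dirderiv_def)

lemma tscale_apply [simp]: "tscale a v c = a *\<^sub>R v c"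
  by (simp add: tscale_def)

lemma uminus_tscale: "- (u :: ('m, 'e::real_vector) tvec) = tscale (- 1) u"
  by (auto simp: fun_eq_iff)

lemma fscale_apply [simp]: "fscale h X p = tscale (h p) (X p)"
  by (simp add: fscale_def)

lemma sum_fun_apply [simp]: "(\<Sum>i\<in>I. F i) x = (\<Sum>i\<in>I. F i x)"
  by (induction I rule: infinite_finite_induct) auto

locale smooth_atlas =
  fixes A :: "('m::{t2_space, second_countable_topology}, 'e::euclidean_space) chart set"
  assumes smooth_manifold: "smooth_manifold A"
begin

lemma
  assumes "c \<in> A"
  shows open_dom: "open (dom_chart c)"
    and open_img: "open (crd c ` dom_chart c)"
    and crd_inv_crd: "\<And>p. p \<in> dom_chart c \<Longrightarrow> crd_inv c (crd c p) = p"
    and continuous_crd: "continuous_on (dom_chart c) (crd c)"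
    and continuous_crd_inv: "continuous_on (crd c ` dom_chart c) (crd_inv c)"
    and smooth_transition:
      "\<And>d. d \<in> A \<Longrightarrow> smooth_on (crd c ` (dom_chart c \<inter> dom_chart d)) (crd d \<circ> crd_inv c)"
  using smooth_manifold assms by (auto simp: smooth_manifold_def homeomorphism_def)

lemma in_carrier: "c \<in> A \<Longrightarrow> p \<in> dom_chart c \<Longrightarrow> p \<in> carrier_of A"
  by (auto simp: carrier_of_def)

lemma carrierE:
  assumes "p \<in> carrier_of A"
  obtains c where "c \<in> A" "p \<in> dom_chart c"
  using assms by (auto simp: carrier_of_def)

lemma open_carrier: "open (carrier_of A)"
  using open_dom by (auto simp: carrier_of_def)

lemma open_crd_image:
  assumes "c \<in> A" "open U"
  shows "open (crd c ` (dom_chart c \<inter> U))"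
proof -
  have "crd c ` (dom_chart c \<inter> U) = crd c ` dom_chart c \<inter> crd_inv c -` U"
    using crd_inv_crd[OF assms(1)] by force
  then show ?thesis
    using continuous_open_preimage[OF continuous_crd_inv open_img] assms by metis
qed

lemma has_derivative_chart_cong:
  assumes "c \<in> A" "p \<in> dom_chart c" "open N" "p \<in> N" "\<And>r. r \<in> N \<Longrightarrow> r \<in> dom_chart c \<Longrightarrow> u r = w r"
  shows "((u \<circ> crd_inv c) has_derivative D) (at (crd c p)) \<longleftrightarrow>
    ((w \<circ> crd_inv c) has_derivative D) (at (crd c p))"
proof -
  have o: "open (crd c ` (dom_chart c \<inter> N))" "crd c p \<in> crd c ` (dom_chart c \<inter> N)"
    using open_crd_image[OF assms(1,3)] assms(2,4) by simp_all
  have "(u \<circ> crd_inv c) x = (w \<circ> crd_inv c) x" if "x \<in> crd c ` (dom_chart c \<inter> N)" for x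
    using that crd_inv_crd[OF assms(1)] assms(5) by auto
  with o show ?thesis
    using has_derivative_transform_within_open[OF _ o, of "u \<circ> crd_inv c" D UNIV "w \<circ> crd_inv c"]
      has_derivative_transform_within_open[OF _ o, of "w \<circ> crd_inv c" D UNIV "u \<circ> crd_inv c"]
    by auto
qed

lemma transition_has_derivative:
  assumes "c \<in> A" "d \<in> A" "p \<in> dom_chart c" "p \<in> dom_chart d"
  shows "((crd d \<circ> crd_inv c) has_derivative
    frechet_derivative (crd d \<circ> crd_inv c) (at (crd c p))) (at (crd c p))"
proof -
  have "Ck_on (Suc 0) (crd c ` (dom_chart c \<inter> dom_chart d)) (crd d \<circ> crd_inv c)"
    using smooth_transition[OF assms(1,2)] unfolding smooth_on_def by blast
  from Ck_on_SucD(1)[OF this] show ?thesis using assms by blast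
qed

text \<open>The chain rule for \<open>u \<circ> crd_inv d\<close> and the transition map. With \<open>u\<close> a third coordinate map it is
  the cocycle rule for differentials of transition maps; in general it makes differentiability and
  directional derivatives independent of the chart.\<close>

lemma chart_change:
  assumes "c \<in> A" "d \<in> A" "p \<in> dom_chart c" "p \<in> dom_chart d"
    and "((u \<circ> crd_inv d) has_derivative D) (at (crd d p))"
  shows "((u \<circ> crd_inv c) has_derivative
    (\<lambda>a. D (frechet_derivative (crd d \<circ> crd_inv c) (at (crd c p)) a))) (at (crd c p))"
proof -
  have "(crd d \<circ> crd_inv c) (crd c p) = crd d p"
    using crd_inv_crd assms by simp
  with diff_chain_at[OF transition_has_derivative[OF assms(1-4)], of "u \<circ> crd_inv d" D] assms(5)
  have "(((u \<circ> (crd_inv d \<circ> crd d)) \<circ> crd_inv c) has_derivative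
      (\<lambda>a. D (frechet_derivative (crd d \<circ> crd_inv c) (at (crd c p)) a))) (at (crd c p))"
    by (simp add: o_def)
  moreover have "(u \<circ> (crd_inv d \<circ> crd d)) r = u r" if "r \<in> dom_chart d" for r
    using crd_inv_crd[OF assms(2) that] by simp
  ultimately show ?thesis
    using has_derivative_chart_cong[OF assms(1,3) open_dom[OF assms(2)] assms(4)] by blast
qed

lemma transition_comp:
  assumes "c \<in> A" "d \<in> A" "e \<in> A" "p \<in> dom_chart c" "p \<in> dom_chart d" "p \<in> dom_chart e"
  shows "frechet_derivative (crd e \<circ> crd_inv c) (at (crd c p)) a =
    frechet_derivative (crd e \<circ> crd_inv d) (at (crd d p))
      (frechet_derivative (crd d \<circ> crd_inv c) (at (crd c p)) a)"
  by (rule fun_cong[OF frechet_derivative_at[OF chart_change[OF assms(1,2,4,5)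
      transition_has_derivative[OF assms(2,3,5,6)]], symmetric]])

lemma transition_id:
  assumes "c \<in> A" "p \<in> dom_chart c"
  shows "frechet_derivative (crd c \<circ> crd_inv c) (at (crd c p)) a = a"
proof -
  have "x = (crd c \<circ> crd_inv c) x" if "x \<in> crd c ` dom_chart c" for x
    using that by (elim imageE) (simp add: crd_inv_crd[OF assms(1)])
  then have "((crd c \<circ> crd_inv c) has_derivative (\<lambda>a. a)) (at (crd c p))"
    by (rule has_derivative_transform_within_open[OF has_derivative_ident open_img[OF assms(1)]
        imageI[OF assms(2)]])
  from fun_cong[OF frechet_derivative_at[OF this], of a] show ?thesis by simp
qed

lemma tvec_of_tangent:
  assumes "c \<in> A" "p \<in> dom_chart c"
  shows "tvec_of A c p a \<in> tangent_space A p"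
  unfolding tangent_space_def mem_Collect_eq
proof (intro conjI allI ballI impI)
  fix d e assume "d \<in> A" "e \<in> A" "p \<in> dom_chart d \<and> p \<in> dom_chart e"
  then show "tvec_of A c p a e =
      frechet_derivative (crd e \<circ> crd_inv d) (at (crd d p)) (tvec_of A c p a d)"
    unfolding tvec_of_def by (simp only: if_True simp_thms) (rule transition_comp; simp add: assms)
next
  fix d assume "\<not> (d \<in> A \<and> p \<in> dom_chart d)"
  then show "tvec_of A c p a d = 0" unfolding tvec_of_def by (rule if_not_P)
qed

lemma tvec_of_chart [simp]:
  assumes "c \<in> A" "p \<in> dom_chart c"
  shows "tvec_of A c p a c = a"
  using assms transition_id by (simp add: tvec_of_def)

lemma tangent_outside: "v \<in> tangent_space A p \<Longrightarrow> \<not> (c \<in> A \<and> p \<in> dom_chart c) \<Longrightarrow> v c = 0"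
  unfolding tangent_space_def by blast

lemma tangent_transition:
  "v \<in> tangent_space A p \<Longrightarrow> c \<in> A \<Longrightarrow> d \<in> A \<Longrightarrow> p \<in> dom_chart c \<Longrightarrow> p \<in> dom_chart d \<Longrightarrow>
    v d = frechet_derivative (crd d \<circ> crd_inv c) (at (crd c p)) (v c)"
  unfolding tangent_space_def by blast

lemma tangentI:
  assumes "\<And>c. \<not> (c \<in> A \<and> p \<in> dom_chart c) \<Longrightarrow> v c = 0"
    and "\<And>c d. c \<in> A \<Longrightarrow> d \<in> A \<Longrightarrow> p \<in> dom_chart c \<Longrightarrow> p \<in> dom_chart d \<Longrightarrow>
      v d = frechet_derivative (crd d \<circ> crd_inv c) (at (crd c p)) (v c)"
  shows "v \<in> tangent_space A p"
  using assms unfolding tangent_space_def by blast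

lemma tangent_eqI:
  assumes "u \<in> tangent_space A p" "v \<in> tangent_space A p" "c \<in> A" "p \<in> dom_chart c" "u c = v c"
  shows "u = v"
proof
  fix d
  show "u d = v d"
    using tangent_outside[OF assms(1), of d] tangent_outside[OF assms(2), of d]
      tangent_transition[OF assms(1,3), of d] tangent_transition[OF assms(2,3), of d] assms(4,5)
    by (cases "d \<in> A \<and> p \<in> dom_chart d") simp_all
qed

lemma tvec_of_tangent_eq:
  "v \<in> tangent_space A p \<Longrightarrow> c \<in> A \<Longrightarrow> p \<in> dom_chart c \<Longrightarrow> tvec_of A c p (v c) = v"
  by (rule tangent_eqI[of _ p _ c]) (simp_all add: tvec_of_tangent)

lemma transition_linear:
  assumes "c \<in> A" "d \<in> A" "p \<in> dom_chart c" "p \<in> dom_chart d"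
  shows "linear (frechet_derivative (crd d \<circ> crd_inv c) (at (crd c p)))"
  using has_derivative_linear transition_has_derivative assms by blast

lemma tangent_add:
  assumes "u \<in> tangent_space A p" "v \<in> tangent_space A p"
  shows "u + v \<in> tangent_space A p"
proof (rule tangentI)
  fix c d assume *: "c \<in> A" "d \<in> A" "p \<in> dom_chart c" "p \<in> dom_chart d"
  show "(u + v) d = frechet_derivative (crd d \<circ> crd_inv c) (at (crd c p)) ((u + v) c)"
    by (simp add: linear_add[OF transition_linear[OF *]] tangent_transition[OF assms(1) *]
        tangent_transition[OF assms(2) *])
qed (simp add: tangent_outside[OF assms(1)] tangent_outside[OF assms(2)])

lemma tangent_scale:
  assumes "u \<in> tangent_space A p"
  shows "tscale a u \<in> tangent_space A p"
proof (rule tangentI)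
  fix c d assume *: "c \<in> A" "d \<in> A" "p \<in> dom_chart c" "p \<in> dom_chart d"
  show "tscale a u d = frechet_derivative (crd d \<circ> crd_inv c) (at (crd c p)) (tscale a u c)"
    by (simp add: linear_scale[OF transition_linear[OF *]] tangent_transition[OF assms(1) *])
qed (simp add: tangent_outside[OF assms(1)])

lemma tangent_0: "0 \<in> tangent_space A p"
  by (rule tangentI) (simp_all add: linear_0[OF transition_linear])

lemma tangent_uminus:
  assumes "u \<in> tangent_space A p"
  shows "- u \<in> tangent_space A p"
proof -
  have "- u = tscale (- 1) u" by (auto simp: fun_eq_iff)
  with tangent_scale[OF assms] show ?thesis by metis
qed

lemma tangent_diff:
  assumes "u \<in> tangent_space A p" "v \<in> tangent_space A p"
  shows "u - v \<in> tangent_space A p"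
  using tangent_add[OF assms(1) tangent_uminus[OF assms(2)]] by simp

lemma tangent_sum:
  assumes "\<And>i. i \<in> I \<Longrightarrow> F i \<in> tangent_space A p"
  shows "(\<Sum>i\<in>I. F i) \<in> tangent_space A p"
  using assms by (induction I rule: infinite_finite_induct) (auto intro: tangent_add tangent_0)

lemma tvec_of_linear:
  assumes "c \<in> A" "p \<in> dom_chart c"
  shows "tvec_of A c p (a + b) = tvec_of A c p a + tvec_of A c p b"
    and "tvec_of A c p (t *\<^sub>R a) = tscale t (tvec_of A c p a)"
  by (rule tangent_eqI[of _ p _ c]; use assms tvec_of_tangent tangent_add tangent_scale in simp)+

lemma tangent_frame:
  assumes "v \<in> tangent_space A p" "c \<in> A" "p \<in> dom_chart c"
  shows "v = (\<Sum>i\<in>Basis. tscale (v c \<bullet> i) (tvec_of A c p i))"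
  by (rule tangent_eqI[of _ p _ c])
    (use assms in \<open>auto intro!: tangent_sum tangent_scale tvec_of_tangent simp: euclidean_representation\<close>)

section \<open>Directional derivatives\<close>

lemma has_dirderivI:
  assumes "c \<in> A" "p \<in> dom_chart c" "((u \<circ> crd_inv c) has_derivative D) (at (crd c p))"
  shows "has_dirderiv A p u (\<lambda>v. D (v c))"
  unfolding has_dirderiv_def differentiable_pt_def
proof (intro conjI ballI impI)
  fix d assume d: "d \<in> A" "p \<in> dom_chart d"
  show "(u \<circ> crd_inv d) differentiable (at (crd d p))"
    using chart_change[OF d(1) assms(1) d(2) assms(2,3)] differentiableI by blast
next
  fix v assume v: "v \<in> tangent_space A p"
  define d where "d = (SOME c. c \<in> A \<and> p \<in> dom_chart c)"
  have d: "d \<in> A \<and> p \<in> dom_chart d"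
    unfolding d_def by (rule someI[of _ c]) (use assms in simp)
  have "dirderiv A u p v = D (frechet_derivative (crd c \<circ> crd_inv d) (at (crd d p)) (v d))"
    unfolding dirderiv_def d_def[symmetric] Let_def
    using fun_cong[OF frechet_derivative_at[OF chart_change[OF conjunct1[OF d] assms(1)
          conjunct2[OF d] assms(2,3)]], of "v d"] by simp
  also have "\<dots> = D (v c)"
    using tangent_transition[OF v, of d c] d assms by simp
  finally show "dirderiv A u p v = D (v c)" .
qed

lemma differentiable_pt_has_derivative:
  assumes "differentiable_pt A u p" "c \<in> A" "p \<in> dom_chart c"
  shows "((u \<circ> crd_inv c) has_derivative frechet_derivative (u \<circ> crd_inv c) (at (crd c p)))
    (at (crd c p))"
  using assms frechet_derivative_works by (auto simp: differentiable_pt_def)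

lemma dirderiv_chart:
  assumes "differentiable_pt A u p" "c \<in> A" "p \<in> dom_chart c" "v \<in> tangent_space A p"
  shows "dirderiv A u p v = frechet_derivative (u \<circ> crd_inv c) (at (crd c p)) (v c)"
  using has_dirderivI[OF assms(2,3) differentiable_pt_has_derivative[OF assms(1-3)]] assms(4)
  by (simp add: has_dirderiv_def)

lemma has_dirderivE:
  assumes "has_dirderiv A p u D" "c \<in> A" "p \<in> dom_chart c"
  obtains D' where "((u \<circ> crd_inv c) has_derivative D') (at (crd c p))"
    "\<And>v. v \<in> tangent_space A p \<Longrightarrow> D v = D' (v c)"
  using assms differentiable_pt_has_derivative dirderiv_chart unfolding has_dirderiv_def by metis

lemma has_dirderiv_eq:
  assumes "has_dirderiv A p u D" "\<And>v. v \<in> tangent_space A p \<Longrightarrow> D v = D' v"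
  shows "has_dirderiv A p u D'"
  using assms by (auto simp: has_dirderiv_def)

lemma has_dirderiv_cong:
  assumes "p \<in> carrier_of A" "open N" "p \<in> N" "\<And>r. r \<in> N \<Longrightarrow> u r = w r" "has_dirderiv A p u D"
  shows "has_dirderiv A p w D"
proof -
  obtain c where c: "c \<in> A" "p \<in> dom_chart c" using assms(1) by (rule carrierE)
  obtain D' where D': "((u \<circ> crd_inv c) has_derivative D') (at (crd c p))"
    "\<And>v. v \<in> tangent_space A p \<Longrightarrow> D v = D' (v c)"
    using has_dirderivE[OF assms(5) c] by blast
  have "((w \<circ> crd_inv c) has_derivative D') (at (crd c p))"
    using D'(1) has_derivative_chart_cong[OF c assms(2,3), of u w] assms(4) by blast
  from has_dirderiv_eq[OF has_dirderivI[OF c this]] D'(2) show ?thesis by simp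
qed

lemma has_dirderiv_bilinear:
  assumes "p \<in> carrier_of A" "bounded_bilinear pr" "has_dirderiv A p u D" "has_dirderiv A p w E"
  shows "has_dirderiv A p (\<lambda>r. pr (u r) (w r)) (\<lambda>v. pr (u p) (E v) + pr (D v) (w p))"
proof -
  obtain c where c: "c \<in> A" "p \<in> dom_chart c" using assms(1) by (rule carrierE)
  obtain D' where D': "((u \<circ> crd_inv c) has_derivative D') (at (crd c p))"
    "\<And>v. v \<in> tangent_space A p \<Longrightarrow> D v = D' (v c)"
    using has_dirderivE[OF assms(3) c] by blast
  obtain E' where E': "((w \<circ> crd_inv c) has_derivative E') (at (crd c p))"
    "\<And>v. v \<in> tangent_space A p \<Longrightarrow> E v = E' (v c)"
    using has_dirderivE[OF assms(4) c] by blast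
  have "(((\<lambda>r. pr (u r) (w r)) \<circ> crd_inv c) has_derivative (\<lambda>a. pr (u p) (E' a) + pr (D' a) (w p)))
      (at (crd c p))"
    using bounded_bilinear.FDERIV[OF assms(2) D'(1) E'(1)] crd_inv_crd[OF c]
    by (simp add: o_def)
  from has_dirderiv_eq[OF has_dirderivI[OF c this]] show ?thesis by (simp add: D'(2) E'(2))
qed

lemma has_dirderiv_add:
  assumes "p \<in> carrier_of A" "has_dirderiv A p u D" "has_dirderiv A p w E"
  shows "has_dirderiv A p (\<lambda>r. u r + w r) (\<lambda>v. D v + E v)"
proof -
  obtain c where c: "c \<in> A" "p \<in> dom_chart c" using assms(1) by (rule carrierE)
  obtain D' where D': "((u \<circ> crd_inv c) has_derivative D') (at (crd c p))"
    "\<And>v. v \<in> tangent_space A p \<Longrightarrow> D v = D' (v c)"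
    using has_dirderivE[OF assms(2) c] by blast
  obtain E' where E': "((w \<circ> crd_inv c) has_derivative E') (at (crd c p))"
    "\<And>v. v \<in> tangent_space A p \<Longrightarrow> E v = E' (v c)"
    using has_dirderivE[OF assms(3) c] by blast
  have "(((\<lambda>r. u r + w r) \<circ> crd_inv c) has_derivative (\<lambda>a. D' a + E' a)) (at (crd c p))"
    using has_derivative_add[OF D'(1) E'(1)] by (simp add: o_def)
  from has_dirderiv_eq[OF has_dirderivI[OF c this]] show ?thesis by (simp add: D'(2) E'(2))
qed

lemma has_dirderiv_const: "p \<in> carrier_of A \<Longrightarrow> has_dirderiv A p (\<lambda>r. k) (\<lambda>v. 0)"
proof -
  assume "p \<in> carrier_of A"
  then obtain c where c: "c \<in> A" "p \<in> dom_chart c" by (rule carrierE)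
  show ?thesis using has_dirderivI[OF c, of "\<lambda>r. k" "\<lambda>a. 0"] by (simp add: o_def)
qed

lemma has_dirderiv_sum:
  assumes "p \<in> carrier_of A" "\<And>i. i \<in> I \<Longrightarrow> has_dirderiv A p (u i) (D i)"
  shows "has_dirderiv A p (\<lambda>r. \<Sum>i\<in>I. u i r) (\<lambda>v. \<Sum>i\<in>I. D i v)"
  using assms(2)
  by (induction I rule: infinite_finite_induct)
    (auto intro: has_dirderiv_add has_dirderiv_const assms(1))

lemma has_dirderiv_bounded_linear:
  assumes "p \<in> carrier_of A" "bounded_linear L" "has_dirderiv A p u D"
  shows "has_dirderiv A p (\<lambda>r. L (u r)) (\<lambda>v. L (D v))"
proof -
  obtain c where c: "c \<in> A" "p \<in> dom_chart c" using assms(1) by (rule carrierE)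
  obtain D' where D': "((u \<circ> crd_inv c) has_derivative D') (at (crd c p))"
    "\<And>v. v \<in> tangent_space A p \<Longrightarrow> D v = D' (v c)"
    using has_dirderivE[OF assms(3) c] by blast
  have "(((\<lambda>r. L (u r)) \<circ> crd_inv c) has_derivative (\<lambda>a. L (D' a))) (at (crd c p))"
    using bounded_linear.has_derivative[OF assms(2) D'(1)] by (simp add: o_def)
  from has_dirderiv_eq[OF has_dirderivI[OF c this]] show ?thesis by (simp add: D'(2))
qed

lemma has_dirderiv_dirderiv:
  "has_dirderiv A p u D \<Longrightarrow> v \<in> tangent_space A p \<Longrightarrow> dirderiv A u p v = D v"
  by (simp add: has_dirderiv_def)

lemma differentiable_pt_chartI:
  assumes "c \<in> A" "p \<in> dom_chart c" "smooth_on S (u \<circ> crd_inv c)" "crd c p \<in> S"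
  shows "differentiable_pt A u p"
proof -
  have "Ck_on (Suc 0) S (u \<circ> crd_inv c)" using assms(3) unfolding smooth_on_def by blast
  from has_dirderivI[OF assms(1,2) Ck_on_SucD(1)[OF this assms(4)]] show ?thesis
    by (simp add: has_dirderiv_def)
qed

lemma differentiable_pt_smooth_fun:
  assumes "smooth_fun A u" "p \<in> carrier_of A"
  shows "differentiable_pt A u p"
proof -
  obtain c where c: "c \<in> A" "p \<in> dom_chart c" using assms(2) by (rule carrierE)
  show ?thesis
    by (rule differentiable_pt_chartI[OF c, of "crd c ` dom_chart c"]) (use assms c in \<open>auto simp: smooth_fun_def\<close>)
qed

section \<open>Vector fields and local frames\<close>

lemma vector_field_tangent: "vector_field A X \<Longrightarrow> X p \<in> tangent_space A p"
  by (simp add: vector_field_def)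

lemma vector_field_smooth:
  "vector_field A X \<Longrightarrow> c \<in> A \<Longrightarrow> smooth_on (crd c ` dom_chart c) ((\<lambda>r. X r c) \<circ> crd_inv c)"
  by (simp add: vector_field_def o_def)

lemma vector_field_differentiable_pt:
  "vector_field A X \<Longrightarrow> c \<in> A \<Longrightarrow> p \<in> dom_chart c \<Longrightarrow> differentiable_pt A (\<lambda>r. X r c) p"
  by (rule differentiable_pt_chartI[OF _ _ vector_field_smooth]) auto

lemma vector_fieldI:
  assumes "\<And>p. X p \<in> tangent_space A p"
    and "\<And>c k. c \<in> A \<Longrightarrow> Ck_on k (crd c ` dom_chart c) ((\<lambda>r. X r c) \<circ> crd_inv c)"
  shows "vector_field A X"
  using assms by (simp add: vector_field_def o_def smooth_on_def)

lemma vector_field_Ck: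
  "vector_field A X \<Longrightarrow> c \<in> A \<Longrightarrow> Ck_on k (crd c ` dom_chart c) ((\<lambda>r. X r c) \<circ> crd_inv c)"
  using vector_field_smooth by (auto simp: smooth_on_def)

lemma smooth_fun_Ck:
  "smooth_fun A h \<Longrightarrow> c \<in> A \<Longrightarrow> Ck_on k (crd c ` dom_chart c) (h \<circ> crd_inv c)"
  by (auto simp: smooth_on_def smooth_fun_def)

lemma vector_field_add:
  assumes "vector_field A X" "vector_field A Y"
  shows "vector_field A (X + Y)"
proof (rule vector_fieldI)
  show "Ck_on k (crd c ` dom_chart c) ((\<lambda>r. (X + Y) r c) \<circ> crd_inv c)" if "c \<in> A" for c k
    using Ck_on_add[OF open_img vector_field_Ck vector_field_Ck, OF that assms(1) that assms(2) that]
    by (simp add: o_def)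
qed (use assms in \<open>auto intro: tangent_add vector_field_tangent\<close>)

lemma vector_field_scale:
  assumes "smooth_fun A h" "vector_field A X"
  shows "vector_field A (fscale h X)"
proof (rule vector_fieldI)
  show "Ck_on k (crd c ` dom_chart c) ((\<lambda>r. fscale h X r c) \<circ> crd_inv c)" if "c \<in> A" for c k
    using Ck_on_scaleR[OF open_img smooth_fun_Ck vector_field_Ck, OF that assms(1) that assms(2) that]
    by (simp add: o_def)
qed (use assms in \<open>auto intro: tangent_scale vector_field_tangent\<close>)

lemma smooth_fun_const: "smooth_fun A (\<lambda>r. k)"
  by (simp add: smooth_fun_def smooth_on_def o_def Ck_on_const)

lemma vector_field_0: "vector_field A 0"
  by (rule vector_fieldI) (auto simp: o_def Ck_on_const tangent_0)

lemma vector_field_sum: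
  assumes "\<And>i. i \<in> I \<Longrightarrow> vector_field A (F i)"
  shows "vector_field A (\<Sum>i\<in>I. F i)"
  using assms
  by (induction I rule: infinite_finite_induct) (auto intro: vector_field_add vector_field_0)

lemma vector_field_uminus:
  assumes "vector_field A X"
  shows "vector_field A (- X)"
proof -
  have "- X = fscale (\<lambda>_. - 1) X" by (auto simp: fun_eq_iff)
  with vector_field_scale[OF smooth_fun_const assms] show ?thesis by metis
qed

lemma vector_field_diff:
  assumes "vector_field A X" "vector_field A Y"
  shows "vector_field A (X - Y)"
  using vector_field_add[OF assms(1) vector_field_uminus[OF assms(2)]] by simp

text \<open>A function with support in a closed subset of the domain of \<open>c\<close> only has to be examined on that
  domain: near every other point it vanishes.\<close>

lemma Ck_on_extend_0:
  assumes "c \<in> A" "d \<in> A" "closed K" "K \<subseteq> dom_chart c" "\<And>r. r \<notin> K \<Longrightarrow> u r = 0"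
    and "Ck_on k (crd d ` (dom_chart d \<inter> dom_chart c)) (u \<circ> crd_inv d)"
  shows "Ck_on k (crd d ` dom_chart d) (u \<circ> crd_inv d)"
proof (rule Ck_on_local)
  fix x assume "x \<in> crd d ` dom_chart d"
  then obtain q where q: "q \<in> dom_chart d" "x = crd d q" by blast
  show "\<exists>U. open U \<and> x \<in> U \<and> Ck_on k U (u \<circ> crd_inv d)"
  proof (cases "q \<in> dom_chart c")
    case True
    then show ?thesis
      using q assms open_crd_image[OF assms(2) open_dom[OF assms(1)]] by blast
  next
    case False
    let ?U = "crd d ` (dom_chart d \<inter> - K)"
    have U: "open ?U" using open_crd_image[OF assms(2)] assms(3) by (simp add: open_Compl)
    have "Ck_on k ?U (u \<circ> crd_inv d)"
      by (rule Ck_on_cong[OF U _ Ck_on_const[of _ _ 0]]) (use assms crd_inv_crd[OF assms(2)] in auto)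
    then show ?thesis using U False q assms(4) by blast
  qed
qed

definition cutoff :: "('m \<Rightarrow> real) \<Rightarrow> 'm set \<Rightarrow> 'm set \<Rightarrow> bool" where
  "cutoff h N K \<longleftrightarrow> smooth_fun A h \<and> open N \<and> (\<forall>r\<in>N. h r = 1) \<and> closed K \<and> (\<forall>r. r \<notin> K \<longrightarrow> h r = 0)"

lemma cutoffD:
  assumes "cutoff h N K"
  shows "smooth_fun A h" "open N" "\<And>r. r \<in> N \<Longrightarrow> h r = 1" "closed K" "\<And>r. r \<notin> K \<Longrightarrow> h r = 0" "N \<subseteq> K"
  using assms by (auto simp: cutoff_def)

text \<open>The bump function of the model space, carried to the manifold by the chart. The Hausdorff property
  enters here: the support is compact, hence closed in the whole manifold, so extension by \<open>0\<close> is
  smooth.\<close>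

lemma cutoff_exists:
  assumes "c \<in> A" "p \<in> dom_chart c" "open U" "p \<in> U"
  obtains h N K where "cutoff h N K" "p \<in> N" "K \<subseteq> dom_chart c \<inter> U"
proof -
  let ?W = "crd c ` (dom_chart c \<inter> U)"
  have "open ?W" "crd c p \<in> ?W" using open_crd_image[OF assms(1,3)] assms by simp_all
  then obtain r where r: "r > 0" "cball (crd c p) r \<subseteq> ?W"
    using open_contains_cball by blast
  obtain b :: "'e \<Rightarrow> real" where b: "smooth_on UNIV b"
    "\<And>x. x \<in> ball (crd c p) (r / 2) \<Longrightarrow> b x = 1" "\<And>x. x \<notin> ball (crd c p) r \<Longrightarrow> b x = 0"
    using smooth_bump[OF r(1)] by blast
  define h where "h q = (if q \<in> dom_chart c then b (crd c q) else 0)" for q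
  define K where "K = crd_inv c ` cball (crd c p) r"
  define N where "N = dom_chart c \<inter> crd c -` ball (crd c p) (r / 2)"
  have KU: "K \<subseteq> dom_chart c \<inter> U"
    using r(2) crd_inv_crd[OF assms(1)] unfolding K_def by force
  have K0: "h q = 0" if "q \<notin> K" for q
  proof (cases "q \<in> dom_chart c")
    case True
    have "crd c q \<notin> ball (crd c p) r"
    proof
      assume "crd c q \<in> ball (crd c p) r"
      then have "crd_inv c (crd c q) \<in> K" unfolding K_def by (intro imageI) auto
      with that show False using crd_inv_crd[OF assms(1) True] by simp
    qed
    then show ?thesis using b(3) by (simp add: h_def)
  qed (simp add: h_def)
  have cK: "closed K"
    unfolding K_def
    by (intro compact_imp_closed compact_continuous_image
        continuous_on_subset[OF continuous_crd_inv[OF assms(1)]] compact_cball) (use r(2) in blast)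
  have "smooth_fun A h"
    unfolding smooth_fun_def smooth_on_def
  proof (intro ballI allI)
    fix d k assume d: "d \<in> A"
    let ?S = "crd d ` (dom_chart d \<inter> dom_chart c)"
    have S: "open ?S" using open_crd_image open_dom d assms(1) by blast
    have t: "Ck_on k ?S (crd c \<circ> crd_inv d)"
      using smooth_transition[OF d assms(1)] by (simp add: smooth_on_def)
    have "Ck_on k UNIV b" using b(1) by (simp add: smooth_on_def)
    from Ck_on_compose[OF S open_UNIV subset_UNIV t this]
    have "Ck_on k ?S (h \<circ> crd_inv d)"
      by (rule Ck_on_cong[OF S, rotated]) (use crd_inv_crd[OF d] in \<open>auto simp: h_def\<close>)
    then show "Ck_on k (crd d ` dom_chart d) (h \<circ> crd_inv d)"
      using Ck_on_extend_0[OF assms(1) d cK] KU K0 by blast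
  qed
  moreover have "open N" unfolding N_def
    by (rule continuous_open_preimage[OF continuous_crd open_dom]) (use assms in auto)
  moreover have "p \<in> N" using assms r(1) by (simp add: N_def)
  moreover have "\<And>q. q \<in> N \<Longrightarrow> h q = 1" using b(2) by (simp add: N_def h_def)
  ultimately show thesis using that[of h N K] cK KU K0 by (simp add: cutoff_def)
qed

text \<open>Global vector fields that form the coordinate frame of \<open>c\<close> on \<open>N\<close>. There is one field for each
  coordinate vector \<open>b\<close>, with a single \<open>N\<close> for all of them.\<close>

definition is_frame :: "('m, 'e) chart \<Rightarrow> 'm set \<Rightarrow> ('e \<Rightarrow> ('m, 'e) vfield) \<Rightarrow> bool" where
  "is_frame c N E \<longleftrightarrow> c \<in> A \<and> open N \<and> N \<subseteq> dom_chart c \<and>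
     (\<forall>b. vector_field A (E b) \<and> (\<forall>r\<in>N. E b r = tvec_of A c r b))"

lemma frame_exists:
  assumes "c \<in> A" "p \<in> dom_chart c"
  obtains N E where "p \<in> N" "is_frame c N E"
proof -
  obtain h N K where "cutoff h N K" and pN: "p \<in> N" and "K \<subseteq> dom_chart c \<inter> UNIV"
    by (rule cutoff_exists[OF assms open_UNIV UNIV_I])
  note h = cutoffD[OF this(1)] and K = this(3)[unfolded Int_UNIV_right]
  define E where "E b = (\<lambda>r. tscale (h r) (tvec_of A c r b))" for b
  have "vector_field A (E b)" for b
  proof (rule vector_fieldI)
    show "E b r \<in> tangent_space A r" for r
    proof (cases "r \<in> dom_chart c")
      case True
      then show ?thesis using tangent_scale tvec_of_tangent assms(1) by (simp add: E_def)
    next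
      case False
      then have "E b r = 0" using h(5)[of r] K by (auto simp: E_def fun_eq_iff)
      then show ?thesis using tangent_0 by simp
    qed
  next
    fix d k assume d: "d \<in> A"
    let ?S = "crd d ` (dom_chart d \<inter> dom_chart c)"
    let ?T = "crd c ` (dom_chart c \<inter> dom_chart d)"
    have S: "open ?S" and T: "open ?T" using open_crd_image open_dom d assms(1) by blast+
    have t: "Ck_on k ?S (crd c \<circ> crd_inv d)"
      using smooth_transition[OF d assms(1)] by (simp add: smooth_on_def)
    have "Ck_on (Suc k) ?T (crd d \<circ> crd_inv c)"
      using smooth_transition[OF assms(1) d] unfolding smooth_on_def by blast
    note t2 = Ck_on_SucD(2)[OF this, of b]
    have "(crd c \<circ> crd_inv d) ` ?S \<subseteq> ?T" using crd_inv_crd[OF d] by auto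
    note t3 = Ck_on_compose[OF S T this t t2]
    have "Ck_on k ?S (h \<circ> crd_inv d)"
      using smooth_fun_Ck[OF h(1) d] by (rule Ck_on_subset) blast
    from Ck_on_scaleR[OF S this t3]
    have "Ck_on k ?S ((\<lambda>r. E b r d) \<circ> crd_inv d)"
      by (rule Ck_on_cong[OF S, rotated])
        (use crd_inv_crd[OF d] d in \<open>auto simp: E_def tvec_of_def\<close>)
    then show "Ck_on k (crd d ` dom_chart d) ((\<lambda>r. E b r d) \<circ> crd_inv d)"
      by (rule Ck_on_extend_0[OF assms(1) d h(4) K, rotated]) (simp add: E_def h(5))
  qed
  then have "is_frame c N E"
    using h K assms by (auto simp: is_frame_def E_def fun_eq_iff)
  with pN that show thesis by blast
qed

lemma vector_field_extending:
  assumes "v \<in> tangent_space A p"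
  obtains X where "vector_field A X" "X p = v"
proof (cases "p \<in> carrier_of A")
  case True
  then obtain c where c: "c \<in> A" "p \<in> dom_chart c" by (rule carrierE)
  obtain E N where "p \<in> N" "is_frame c N E" using frame_exists[OF c] by blast
  then have "vector_field A (E (v c))" "E (v c) p = v"
    using tvec_of_tangent_eq[OF assms c] by (auto simp: is_frame_def)
  with that show thesis by blast
next
  case False
  then have "v = 0" using assms by (auto simp: tangent_space_def carrier_of_def fun_eq_iff)
  with that[OF vector_field_0] show thesis by simp
qed

text \<open>The coordinate functions of a field live on the domain of the chart only. To multiply global fields
  by them they are replaced by global functions with the same germ at \<open>p\<close>.\<close>

lemma coordinates_extend:
  assumes "c \<in> A" "p \<in> dom_chart c" "vector_field A X"
  obtains N y where "open N" "p \<in> N" "\<forall>i. smooth_fun A (y i)"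
    "\<forall>i. \<forall>r\<in>N. y i r = X r c \<bullet> i"
proof -
  obtain h N K where "cutoff h N K" and pN: "p \<in> N" and "K \<subseteq> dom_chart c \<inter> UNIV"
    by (rule cutoff_exists[OF assms(1,2) open_UNIV UNIV_I])
  note h = cutoffD[OF this(1)] and K = this(3)[unfolded Int_UNIV_right]
  define y where "y i r = h r * (X r c \<bullet> i)" for i r
  have "smooth_fun A (y i)" for i
    unfolding smooth_fun_def smooth_on_def
  proof (intro ballI allI)
    fix d k assume d: "d \<in> A"
    let ?S = "crd d ` (dom_chart d \<inter> dom_chart c)"
    let ?T = "crd c ` dom_chart c"
    have S: "open ?S" using open_crd_image open_dom d assms(1) by blast
    have t: "Ck_on k ?S (crd c \<circ> crd_inv d)"
      using smooth_transition[OF d assms(1)] by (simp add: smooth_on_def)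
    have "(crd c \<circ> crd_inv d) ` ?S \<subseteq> ?T" using crd_inv_crd[OF d] by auto
    note t3 = Ck_on_inner[OF S Ck_on_compose[OF S open_img[OF assms(1)] this t
          vector_field_Ck[OF assms(3,1)]], of i]
    have "Ck_on k ?S (h \<circ> crd_inv d)"
      using smooth_fun_Ck[OF h(1) d] by (rule Ck_on_subset) blast
    from Ck_on_mult[OF S this t3]
    have "Ck_on k ?S (y i \<circ> crd_inv d)"
      by (rule Ck_on_cong[OF S, rotated])
        (use crd_inv_crd[OF d] crd_inv_crd[OF assms(1)] in \<open>auto simp: y_def\<close>)
    then show "Ck_on k (crd d ` dom_chart d) (y i \<circ> crd_inv d)"
      by (rule Ck_on_extend_0[OF assms(1) d h(4) K, rotated]) (simp add: y_def h(5))
  qed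
  then show thesis using that[of N y] h pN by (simp add: y_def)
qed

end

lemma (in smooth_atlas) is_frameD:
  assumes "is_frame c N E"
  shows "c \<in> A" "open N" "N \<subseteq> dom_chart c" "\<And>b. vector_field A (E b)"
    "\<And>r b. r \<in> N \<Longrightarrow> E b r = tvec_of A c r b" "\<And>r b. r \<in> N \<Longrightarrow> E b r c = b"
proof -
  show c: "c \<in> A" "open N" "N \<subseteq> dom_chart c" "\<And>b. vector_field A (E b)"
    "\<And>r b. r \<in> N \<Longrightarrow> E b r = tvec_of A c r b"
    using assms unfolding is_frame_def by blast+
  show "E b r c = b" if "r \<in> N" for r b
    using c(5)[OF that] tvec_of_chart[OF c(1)] c(3) that by (metis subsetD)
qed

lemma (in smooth_atlas) frame_representation:
  assumes "is_frame c N E" "r \<in> N" "v \<in> tangent_space A r"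
  shows "v = (\<Sum>i\<in>Basis. tscale (v c \<bullet> i) (E i r))"
  unfolding is_frameD(5)[OF assms(1,2)]
  by (rule tangent_frame[OF assms(3) is_frameD(1)[OF assms(1)]
        subsetD[OF is_frameD(3)[OF assms(1)] assms(2)]])

lemma (in smooth_atlas) vector_field_frame:
  assumes "is_frame c N E" "p \<in> N" "vector_field A X"
  obtains M y where "open M" "p \<in> M" "\<forall>i. smooth_fun A (y i)"
    "\<forall>i. \<forall>r\<in>M. y i r = X r c \<bullet> i"
    "\<forall>r\<in>M. X r = (\<Sum>i\<in>Basis. fscale (y i) (E i)) r"
proof -
  note E = is_frameD[OF assms(1)]
  have pc: "p \<in> dom_chart c" using E(3) assms(2) by blast
  obtain M y where y: "open M" "p \<in> M" "\<forall>i. smooth_fun A (y i)"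
    "\<forall>i. \<forall>r\<in>M. y i r = X r c \<bullet> i"
    by (rule coordinates_extend[OF E(1) pc assms(3)])
  have "X r = (\<Sum>i\<in>Basis. fscale (y i) (E i)) r" if "r \<in> M \<inter> N" for r
  proof -
    have "(\<Sum>i\<in>Basis. fscale (y i) (E i)) r = (\<Sum>i\<in>Basis. tscale (X r c \<bullet> i) (E i r))"
      using y(4) that by simp
    also have "\<dots> = X r"
      using frame_representation[OF assms(1) _ vector_field_tangent[OF assms(3)], of r] that by (metis IntD2)
    finally show ?thesis by simp
  qed
  then show thesis
    using that[of "M \<inter> N" y] y assms(2) E(2) by auto
qed

lemma (in smooth_atlas) dirderiv_cong:
  assumes "p \<in> carrier_of A" "open N" "p \<in> N" "\<And>r. r \<in> N \<Longrightarrow> u r = w r" "differentiable_pt A u p"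
    "v \<in> tangent_space A p"
  shows "dirderiv A u p v = dirderiv A w p v"
  using has_dirderiv_dirderiv[OF has_dirderiv_cong[OF assms(1-4) has_dirderiv_differentiable_pt[OF assms(5)]] assms(6)]
  by simp

lemma (in smooth_atlas) dirderiv_add:
  assumes "p \<in> carrier_of A" "differentiable_pt A u p" "v \<in> tangent_space A p" "w \<in> tangent_space A p"
  shows "dirderiv A u p (v + w) = dirderiv A u p v + dirderiv A u p w"
proof -
  obtain c where c: "c \<in> A" "p \<in> dom_chart c" using assms(1) by (rule carrierE)
  show ?thesis
    using linear_add[OF has_derivative_linear[OF differentiable_pt_has_derivative[OF assms(2) c]]]
    by (simp add: dirderiv_chart[OF assms(2) c] assms tangent_add)
qed

lemma (in smooth_atlas) dirderiv_scale:
  assumes "p \<in> carrier_of A" "differentiable_pt A u p" "v \<in> tangent_space A p"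
  shows "dirderiv A u p (tscale a v) = a *\<^sub>R dirderiv A u p v"
proof -
  obtain c where c: "c \<in> A" "p \<in> dom_chart c" using assms(1) by (rule carrierE)
  show ?thesis
    using linear_scale[OF has_derivative_linear[OF differentiable_pt_has_derivative[OF assms(2) c]]]
    by (simp add: dirderiv_chart[OF assms(2) c] assms tangent_scale)
qed

lemma (in smooth_atlas) dirderiv_coordinate:
  assumes "p \<in> carrier_of A" "differentiable_pt A u p"
  shows "has_dirderiv A p (\<lambda>r. u r \<bullet> i) (\<lambda>v. dirderiv A u p v \<bullet> i)"
  by (rule has_dirderiv_bounded_linear[OF assms(1) bounded_linear_inner_left
        has_dirderiv_differentiable_pt[OF assms(2)]])

section \<open>Connections\<close>

text \<open>Connections act on global vector fields only, so their locality has to be proved. The aim is the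
  coordinate expression of \<open>nabla\<close> at a point and the evaluation of \<open>christoffel\<close>, which is defined by
  choosing fields.\<close>

locale affine_conn = smooth_atlas A
  for A :: "('m::{t2_space, second_countable_topology}, 'e::euclidean_space) chart set" +
  fixes nabla :: "('m, 'e) connection"
  assumes affine: "affine_connection A nabla"
begin

lemma nabla_field: "vector_field A X \<Longrightarrow> vector_field A Y \<Longrightarrow> vector_field A (nabla X Y)"
  using affine by (simp add: affine_connection_def)

lemma nabla_add_left:
  "vector_field A X \<Longrightarrow> vector_field A Y \<Longrightarrow> vector_field A Z \<Longrightarrow>
    nabla (X + Y) Z p = nabla X Z p + nabla Y Z p"
  using affine by (simp add: affine_connection_def)

lemma nabla_add_right:
  "vector_field A X \<Longrightarrow> vector_field A Y \<Longrightarrow> vector_field A Z \<Longrightarrow>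
    nabla X (Y + Z) p = nabla X Y p + nabla X Z p"
  using affine by (simp add: affine_connection_def)

lemma nabla_scale_left:
  "vector_field A X \<Longrightarrow> vector_field A Y \<Longrightarrow> smooth_fun A h \<Longrightarrow>
    nabla (fscale h X) Y p = tscale (h p) (nabla X Y p)"
  using affine by (simp add: affine_connection_def)

lemma nabla_scale_right:
  "vector_field A X \<Longrightarrow> vector_field A Y \<Longrightarrow> smooth_fun A h \<Longrightarrow>
    nabla X (fscale h Y) p =
      tscale (h p) (nabla X Y p) + tscale (dirderiv A h p (X p)) (Y p)"
  using affine by (simp add: affine_connection_def)

lemma nabla_0_left: "vector_field A Y \<Longrightarrow> nabla 0 Y p = 0"
  using nabla_add_left[OF vector_field_0 vector_field_0, of Y p] by simp

lemma nabla_0_right: "vector_field A X \<Longrightarrow> nabla X 0 p = 0"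
  using nabla_add_right[OF _ vector_field_0 vector_field_0, of X p] by simp

lemma nabla_sum_left:
  assumes "vector_field A Y" "\<And>i. i \<in> I \<Longrightarrow> vector_field A (F i)"
  shows "nabla (\<Sum>i\<in>I. F i) Y p = (\<Sum>i\<in>I. nabla (F i) Y p)"
  using assms(2)
  by (induction I rule: infinite_finite_induct)
    (simp_all add: nabla_0_left nabla_add_left vector_field_sum assms(1))

lemma nabla_sum_right:
  assumes "vector_field A X" "\<And>i. i \<in> I \<Longrightarrow> vector_field A (F i)"
  shows "nabla X (\<Sum>i\<in>I. F i) p = (\<Sum>i\<in>I. nabla X (F i) p)"
  using assms(2)
  by (induction I rule: infinite_finite_induct)
    (simp_all add: nabla_0_right nabla_add_right vector_field_sum assms(1))

text \<open>If \<open>Y\<close> and \<open>Y'\<close> agree near \<open>p\<close>, they become equal on the whole manifold after multiplication by a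
  cutoff function \<open>h\<close> with support in \<open>U\<close> and \<open>h p = 1\<close>. Comparing the two values of \<open>nabla\<close> at \<open>p\<close>, the Leibniz terms
  agree because \<open>Y p = Y' p\<close>.\<close>

lemma
  assumes "p \<in> carrier_of A" "open U" "p \<in> U" "\<And>r. r \<in> U \<Longrightarrow> Y r = Y' r"
    and "vector_field A X" "vector_field A Y" "vector_field A Y'"
  shows nabla_local_left: "nabla Y X p = nabla Y' X p"
    and nabla_local_right: "nabla X Y p = nabla X Y' p"
proof -
  obtain c where c: "c \<in> A" "p \<in> dom_chart c" using assms(1) by (rule carrierE)
  obtain h N K where hNK: "cutoff h N K" "p \<in> N" "K \<subseteq> dom_chart c \<inter> U"
    by (rule cutoff_exists[OF c assms(2,3)])
  note h = cutoffD[OF hNK(1)]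
  have eq: "fscale h Y = fscale h Y'"
  proof (rule ext)
    fix r
    show "fscale h Y r = fscale h Y' r"
      using assms(4)[of r] h(5)[of r] hNK(3) by (cases "r \<in> K") (auto simp: fun_eq_iff)
  qed
  have one: "h p = 1" using h(3) hNK(2) by simp
  show "nabla Y X p = nabla Y' X p"
    using nabla_scale_left[OF assms(6,5) h(1), of p] nabla_scale_left[OF assms(7,5) h(1), of p]
    by (simp add: eq one fun_eq_iff)
  show "nabla X Y p = nabla X Y' p"
    using nabla_scale_right[OF assms(5,6) h(1), of p] nabla_scale_right[OF assms(5,7) h(1), of p]
      assms(4)[OF assms(3)]
    by (simp add: eq one fun_eq_iff)
qed

lemma nabla_frame_left:
  assumes "is_frame c N E" "p \<in> N" "vector_field A X" "vector_field A Y"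
  shows "nabla X Y p = (\<Sum>i\<in>Basis. tscale (X p c \<bullet> i) (nabla (E i) Y p))"
proof -
  note E = is_frameD[OF assms(1)]
  have p: "p \<in> carrier_of A" using in_carrier[OF E(1)] E(3) assms(2) by blast
  obtain M y where y: "open M" "p \<in> M" "\<forall>i. smooth_fun A (y i)"
    "\<forall>i. \<forall>r\<in>M. y i r = X r c \<bullet> i"
    "\<forall>r\<in>M. X r = (\<Sum>i\<in>Basis. fscale (y i) (E i)) r"
    by (rule vector_field_frame[OF assms(1-3)])
  note y = y(1,2) y(3-5)[rule_format]
  have f: "vector_field A (fscale (y i) (E i))" for i
    by (rule vector_field_scale[OF y(3) E(4)])
  have "nabla X Y p = nabla (\<Sum>i\<in>Basis. fscale (y i) (E i)) Y p"
    by (rule nabla_local_left[OF p y(1,2,5) assms(4,3) vector_field_sum[OF f]])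
  also have "\<dots> = (\<Sum>i\<in>Basis. tscale (X p c \<bullet> i) (nabla (E i) Y p))"
    by (simp add: nabla_sum_left[OF assms(4) f] nabla_scale_left[OF E(4) assms(4) y(3)] y(4)[OF y(2)])
  finally show ?thesis .
qed

lemma nabla_tensor_left:
  assumes "p \<in> carrier_of A" "vector_field A X" "vector_field A X'" "vector_field A Y" "X p = X' p"
  shows "nabla X Y p = nabla X' Y p"
proof -
  obtain c where c: "c \<in> A" "p \<in> dom_chart c" using assms(1) by (rule carrierE)
  obtain N E where E: "p \<in> N" "is_frame c N E" by (rule frame_exists[OF c])
  show ?thesis
    unfolding nabla_frame_left[OF E(2,1) assms(2,4)] nabla_frame_left[OF E(2,1) assms(3,4)] assms(5)
    by (rule refl)
qed

lemma nabla_frame_right: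
  assumes "is_frame c N E" "p \<in> N" "vector_field A X" "vector_field A Y"
  shows "nabla X Y p = (\<Sum>i\<in>Basis. tscale (Y p c \<bullet> i) (nabla X (E i) p)
    + tscale (dirderiv A (\<lambda>r. Y r c) p (X p) \<bullet> i) (E i p))"
proof -
  note E = is_frameD[OF assms(1)]
  have pc: "p \<in> dom_chart c" using E(3) assms(2) by blast
  have p: "p \<in> carrier_of A" by (rule in_carrier[OF E(1) pc])
  obtain M y where y: "open M" "p \<in> M" "\<forall>i. smooth_fun A (y i)"
    "\<forall>i. \<forall>r\<in>M. y i r = Y r c \<bullet> i"
    "\<forall>r\<in>M. Y r = (\<Sum>i\<in>Basis. fscale (y i) (E i)) r"
    by (rule vector_field_frame[OF assms(1,2,4)])
  note y = y(1,2) y(3-5)[rule_format]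
  have f: "vector_field A (fscale (y i) (E i))" for i
    by (rule vector_field_scale[OF y(3) E(4)])
  have X: "X p \<in> tangent_space A p" by (rule vector_field_tangent[OF assms(3)])
  have d: "dirderiv A (y i) p (X p) = dirderiv A (\<lambda>r. Y r c) p (X p) \<bullet> i" for i
    using dirderiv_cong[OF p y(1,2,4) differentiable_pt_smooth_fun[OF y(3) p] X, of i]
      has_dirderiv_dirderiv[OF dirderiv_coordinate[OF p vector_field_differentiable_pt[OF assms(4) E(1) pc]] X, of i]
    by simp
  have "nabla X Y p = nabla X (\<Sum>i\<in>Basis. fscale (y i) (E i)) p"
    by (rule nabla_local_right[OF p y(1,2,5) assms(3,4) vector_field_sum[OF f]])
  also have "\<dots> = (\<Sum>i\<in>Basis. tscale (Y p c \<bullet> i) (nabla X (E i) p)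
    + tscale (dirderiv A (\<lambda>r. Y r c) p (X p) \<bullet> i) (E i p))"
    by (simp add: nabla_sum_right[OF assms(3) f] nabla_scale_right[OF assms(3) E(4) y(3)] y(4)[OF y(2)] d)
  finally show ?thesis .
qed

text \<open>The two fields chosen in the definition of \<open>christoffel\<close> may be replaced: the first by any field
  with the same value at \<open>q\<close>, the second by any field with the same germ at \<open>q\<close>.\<close>

lemma christoffel_frame:
  assumes "is_frame d N E" "q \<in> N" "vector_field A X"
  shows "christoffel A nabla d q (X q d) b = nabla X (E b) q d"
proof -
  note E = is_frameD[OF assms(1)]
  have d: "q \<in> dom_chart d" using E(3) assms(2) by blast
  have q: "q \<in> carrier_of A" by (rule in_carrier[OF E(1) d])
  define X' where "X' = (SOME X'. vector_field A X' \<and> X' q d = X q d)"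
  define Y where "Y = (SOME Y. vector_field A Y \<and>
    (\<exists>N. open N \<and> q \<in> N \<and> N \<subseteq> dom_chart d \<and> (\<forall>r\<in>N. Y r d = b)))"
  have X': "vector_field A X' \<and> X' q d = X q d"
    unfolding X'_def by (rule someI[of _ X]) (use assms(3) in simp)
  have Y: "vector_field A Y \<and> (\<exists>N. open N \<and> q \<in> N \<and> N \<subseteq> dom_chart d \<and> (\<forall>r\<in>N. Y r d = b))"
    unfolding Y_def by (rule someI[of _ "E b"]) (intro conjI exI[of _ N] ballI E assms(2))
  then obtain M where M: "open M" "q \<in> M" "M \<subseteq> dom_chart d" "\<And>r. r \<in> M \<Longrightarrow> Y r d = b" by blast
  note Yf = conjunct1[OF Y] and X'f = conjunct1[OF X']
  have eq: "Y r = E b r" if "r \<in> M \<inter> N" for r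
  proof (rule tangent_eqI[OF vector_field_tangent[OF Yf] vector_field_tangent[OF E(4)] E(1)])
    show "r \<in> dom_chart d" using that E(3) by blast
    show "Y r d = E b r d" using that M(4)[of r] E(6)[of r b] by simp
  qed
  have "open (M \<inter> N)" "q \<in> M \<inter> N" using M E(2) assms(2) by auto
  note nabla_local_right[OF q this eq X'f Yf E(4)]
  also have "X' q = X q"
    by (rule tangent_eqI[OF vector_field_tangent[OF X'f] vector_field_tangent[OF assms(3)] E(1) d
          conjunct2[OF X']])
  note nabla_tensor_left[OF q X'f assms(3) E(4) this]
  finally show ?thesis
    by (simp add: christoffel_def X'_def Y_def)
qed

lemma christoffel_basis:
  assumes "d \<in> A" "q \<in> dom_chart d"
  shows "christoffel A nabla d q a b = (\<Sum>i\<in>Basis. (b \<bullet> i) *\<^sub>R christoffel A nabla d q a i)"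
proof -
  obtain N E where E: "q \<in> N" "is_frame d N E" by (rule frame_exists[OF assms])
  note F = is_frameD[OF E(2)]
  have q: "q \<in> carrier_of A" by (rule in_carrier[OF assms])
  have X: "E a q \<in> tangent_space A q" by (rule vector_field_tangent[OF F(4)])
  have g: "christoffel A nabla d q a b = nabla (E a) (E b) q d" for b
    using christoffel_frame[OF E(2,1) F(4), of a b] F(6)[OF E(1)] by simp
  have "dirderiv A (\<lambda>r. E b r d) q (E a q) = dirderiv A (\<lambda>r. b) q (E a q)"
    by (rule dirderiv_cong[OF q F(2) E(1) F(6) vector_field_differentiable_pt[OF F(4) assms] X])
  also have "\<dots> = 0" using has_dirderiv_dirderiv[OF has_dirderiv_const[OF q] X] .
  finally show ?thesis
    unfolding g using nabla_frame_right[OF E(2,1) F(4) F(4), of a b] F(6)[OF E(1)] by simp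
qed

lemma christoffel_linear:
  assumes "d \<in> A" "q \<in> dom_chart d"
  shows "linear (christoffel A nabla d q a)"
proof -
  define G where "G = christoffel A nabla d q a"
  have G: "G = (\<lambda>b. \<Sum>i\<in>Basis. (b \<bullet> i) *\<^sub>R G i)"
    unfolding G_def by (rule ext) (rule christoffel_basis[OF assms])
  have "linear (\<lambda>b. \<Sum>i\<in>Basis. (b \<bullet> i) *\<^sub>R G i)"
    by (rule linearI)
      (simp_all add: inner_add_left scaleR_add_left sum.distrib scaleR_sum_right)
  then show ?thesis unfolding G_def[symmetric] by (subst G)
qed

text \<open>The classical \<open>\<nabla>\<^sub>X Y = dY(X) + \<Gamma>(X, Y)\<close>.\<close>

lemma nabla_local_formula:
  assumes "d \<in> A" "q \<in> dom_chart d" "vector_field A X" "vector_field A Y"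
  shows "nabla X Y q d = dirderiv A (\<lambda>r. Y r d) q (X q) + christoffel A nabla d q (X q d) (Y q d)"
proof -
  obtain N E where E: "q \<in> N" "is_frame d N E" by (rule frame_exists[OF assms(1,2)])
  note F = is_frameD[OF E(2)]
  have "nabla X Y q d = (\<Sum>i\<in>Basis. (Y q d \<bullet> i) *\<^sub>R nabla X (E i) q d
      + (dirderiv A (\<lambda>r. Y r d) q (X q) \<bullet> i) *\<^sub>R i)"
    using nabla_frame_right[OF E(2,1) assms(3,4)] F(6)[OF E(1)] by simp
  also have "\<dots> = (\<Sum>i\<in>Basis. (Y q d \<bullet> i) *\<^sub>R christoffel A nabla d q (X q d) i)
      + dirderiv A (\<lambda>r. Y r d) q (X q)"
    by (simp add: sum.distrib christoffel_frame[OF E(2,1) assms(3)] euclidean_representation)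
  finally show ?thesis by (simp add: christoffel_basis[OF assms(1,2), of _ "Y q d"] add.commute)
qed

end

section \<open>Sections along a map\<close>

locale manifold_map = A: smooth_atlas A + B: smooth_atlas B
  for A :: "('m::{t2_space, second_countable_topology}, 'e::euclidean_space) chart set"
    and B :: "('n::{t2_space, second_countable_topology}, 'f::euclidean_space) chart set" +
  fixes f :: "'m \<Rightarrow> 'n"
  assumes smooth_map: "smooth_map A B f"
begin

abbreviation pf where "pf \<equiv> pushforward A B f"

lemma f_carrier: "p \<in> carrier_of A \<Longrightarrow> f p \<in> carrier_of B"
  using smooth_map by (auto simp: smooth_map_def)

lemma open_preimage: "open V \<Longrightarrow> open (carrier_of A \<inter> f -` V)"
  using continuous_open_preimage[OF _ A.open_carrier] smooth_map by (auto simp: smooth_map_def)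

lemma smooth_coordinates:
  assumes "c \<in> A" "d \<in> B"
  shows "smooth_on (crd c ` (dom_chart c \<inter> f -` dom_chart d)) ((crd d \<circ> f) \<circ> crd_inv c)"
  using smooth_map assms unfolding smooth_map_def by blast

lemma differentiable_pt_coordinates:
  assumes "p \<in> carrier_of A" "d \<in> B" "f p \<in> dom_chart d"
  shows "differentiable_pt A (crd d \<circ> f) p"
proof -
  obtain c where c: "c \<in> A" "p \<in> dom_chart c" using assms(1) by (rule A.carrierE)
  show ?thesis
    by (rule A.differentiable_pt_chartI[OF c smooth_coordinates[OF c(1) assms(2)]]) (use c assms in auto)
qed

lemma chain_rule_chart:
  assumes "p \<in> carrier_of A" "d \<in> B" "f p \<in> dom_chart d"
    and "((u \<circ> crd_inv d) has_derivative D) (at (crd d (f p)))"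
  shows "has_dirderiv A p (\<lambda>r. u (f r)) (\<lambda>v. D (dirderiv A (crd d \<circ> f) p v))"
proof -
  obtain c where c: "c \<in> A" "p \<in> dom_chart c" using assms(1) by (rule A.carrierE)
  note m = differentiable_pt_coordinates[OF assms(1-3)]
  let ?F = "frechet_derivative (crd d \<circ> f \<circ> crd_inv c) (at (crd c p))"
  have "((u \<circ> crd_inv d) has_derivative D) (at ((crd d \<circ> f \<circ> crd_inv c) (crd c p)))"
    using assms(4) A.crd_inv_crd[OF c] by simp
  from diff_chain_at[OF A.differentiable_pt_has_derivative[OF m c] this]
  have "(((\<lambda>r. u (crd_inv d (crd d (f r)))) \<circ> crd_inv c) has_derivative D \<circ> ?F) (at (crd c p))"
    by (simp add: o_def)
  from A.has_dirderivI[OF c this]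
  have "has_dirderiv A p (\<lambda>r. u (crd_inv d (crd d (f r)))) (\<lambda>v. D (dirderiv A (crd d \<circ> f) p v))"
    by (rule A.has_dirderiv_eq) (simp add: A.dirderiv_chart[OF m c])
  then show ?thesis
    by (rule A.has_dirderiv_cong[OF assms(1) open_preimage[OF B.open_dom[OF assms(2)]], rotated 2])
      (use assms(1,3) B.crd_inv_crd[OF assms(2)] in auto)
qed

lemma pushforward_chart:
  "d \<in> B \<Longrightarrow> f p \<in> dom_chart d \<Longrightarrow> pf p v d = dirderiv A (crd d \<circ> f) p v"
  by (simp add: pushforward_def)

lemma pushforward_tangent:
  assumes "p \<in> carrier_of A" "v \<in> tangent_space A p"
  shows "pf p v \<in> tangent_space B (f p)"
proof (rule B.tangentI)
  fix d e assume *: "d \<in> B" "e \<in> B" "f p \<in> dom_chart d" "f p \<in> dom_chart e"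
  show "pf p v e = frechet_derivative (crd e \<circ> crd_inv d) (at (crd d (f p))) (pf p v d)"
    using A.has_dirderiv_dirderiv[OF chain_rule_chart[OF assms(1) *(1,3)
          B.transition_has_derivative[OF *]] assms(2)] *
    by (simp add: pushforward_def o_def)
qed (auto simp: pushforward_def)

lemma pushforward_add:
  assumes "p \<in> carrier_of A" "u \<in> tangent_space A p" "v \<in> tangent_space A p"
  shows "pf p (u + v) = pf p u + pf p v"
proof (rule ext)
  fix d
  show "pf p (u + v) d = (pf p u + pf p v) d"
    using A.dirderiv_add[OF assms(1) differentiable_pt_coordinates[OF assms(1)] assms(2,3), of d]
    by (auto simp: pushforward_def)
qed

lemma pushforward_scale:
  assumes "p \<in> carrier_of A" "v \<in> tangent_space A p"
  shows "pf p (tscale a v) = tscale a (pf p v)"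
proof (rule ext)
  fix d
  show "pf p (tscale a v) d = tscale a (pf p v) d"
    using A.dirderiv_scale[OF assms(1) differentiable_pt_coordinates[OF assms(1)] assms(2), of d a]
    by (auto simp: pushforward_def)
qed

lemma chain_rule:
  assumes "p \<in> carrier_of A" "differentiable_pt B u (f p)"
  shows "has_dirderiv A p (\<lambda>r. u (f r)) (\<lambda>v. dirderiv B u (f p) (pf p v))"
proof -
  obtain d where d: "d \<in> B" "f p \<in> dom_chart d" using f_carrier[OF assms(1)] by (rule B.carrierE)
  show ?thesis
    by (rule A.has_dirderiv_eq[OF chain_rule_chart[OF assms(1) d B.differentiable_pt_has_derivative[OF assms(2) d]]])
      (simp add: B.dirderiv_chart[OF assms(2) d pushforward_tangent[OF assms(1)]] pushforward_chart d)
qed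

text \<open>Vector fields along \<open>f\<close> that are differentiable at the point \<open>p\<close>. This covers the local unit
  normal fields as well as the pushforwards of vector fields.\<close>

definition diff_section :: "('m \<Rightarrow> ('n, 'f) tvec) \<Rightarrow> 'm \<Rightarrow> bool" where
  "diff_section V p \<longleftrightarrow> p \<in> carrier_of A \<and>
     (\<exists>W. open W \<and> p \<in> W \<and> (\<forall>r\<in>W. V r \<in> tangent_space B (f r))) \<and>
     (\<forall>d\<in>B. f p \<in> dom_chart d \<longrightarrow> differentiable_pt A (\<lambda>r. V r d) p)"

lemma diff_sectionD:
  assumes "diff_section V p"
  shows "p \<in> carrier_of A" "V p \<in> tangent_space B (f p)"
    "\<And>d. d \<in> B \<Longrightarrow> f p \<in> dom_chart d \<Longrightarrow> differentiable_pt A (\<lambda>r. V r d) p"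
  using assms unfolding diff_section_def by blast+

lemma diff_section_near:
  assumes "diff_section V p" "open N" "f p \<in> N"
  obtains W where "open W" "p \<in> W" "\<And>r. r \<in> W \<Longrightarrow> V r \<in> tangent_space B (f r)"
    "\<And>r. r \<in> W \<Longrightarrow> f r \<in> N"
proof -
  obtain W where W: "open W" "p \<in> W" "\<And>r. r \<in> W \<Longrightarrow> V r \<in> tangent_space B (f r)"
    using assms(1) unfolding diff_section_def by blast
  show thesis
    by (rule that[of "W \<inter> (carrier_of A \<inter> f -` N)"])
      (use W assms(3) diff_sectionD(1)[OF assms(1)] open_preimage[OF assms(2)] in auto)
qed

lemma diff_section_along:
  assumes "section_along A B f U V" "open U" "U \<subseteq> carrier_of A" "p \<in> U"
  shows "diff_section V p"
  unfolding diff_section_def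
proof (intro conjI ballI impI)
  show p: "p \<in> carrier_of A" using assms by blast
  show "\<exists>W. open W \<and> p \<in> W \<and> (\<forall>r\<in>W. V r \<in> tangent_space B (f r))"
    using assms unfolding section_along_def by blast
  fix d assume d: "d \<in> B" "f p \<in> dom_chart d"
  obtain c where c: "c \<in> A" "p \<in> dom_chart c" using p by (rule A.carrierE)
  have "smooth_on (crd c ` (dom_chart c \<inter> U \<inter> f -` dom_chart d)) ((\<lambda>r. V r d) \<circ> crd_inv c)"
    using assms(1) c d unfolding section_along_def o_def by blast
  then show "differentiable_pt A (\<lambda>r. V r d) p"
    by (rule A.differentiable_pt_chartI[OF c]) (use c d assms in auto)
qed

text \<open>In coordinates \<open>pf r (Y r)\<close> is the differential of \<open>f\<close> at \<open>r\<close> applied to \<open>Y r\<close>. Expanding \<open>Y r\<close> in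
  the standard basis exhibits it as a finite sum of products of smooth functions.\<close>

lemma diff_section_pushforward:
  assumes "p \<in> carrier_of A" "vector_field A Y"
  shows "diff_section (\<lambda>r. pf r (Y r)) p"
  unfolding diff_section_def
proof (intro conjI ballI impI)
  show "p \<in> carrier_of A" by fact
  show "\<exists>W. open W \<and> p \<in> W \<and> (\<forall>r\<in>W. pf r (Y r) \<in> tangent_space B (f r))"
    using A.open_carrier assms pushforward_tangent A.vector_field_tangent[OF assms(2)] by blast
  fix d assume d: "d \<in> B" "f p \<in> dom_chart d"
  obtain c where c: "c \<in> A" "p \<in> dom_chart c" using assms(1) by (rule A.carrierE)
  let ?S = "crd c ` (dom_chart c \<inter> f -` dom_chart d)"
  let ?F = "crd d \<circ> f \<circ> crd_inv c"
  have "dom_chart c \<inter> f -` dom_chart d = dom_chart c \<inter> (carrier_of A \<inter> f -` dom_chart d)"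
    using A.in_carrier[OF c(1)] by blast
  then have S: "open ?S"
    using A.open_crd_image[OF c(1) open_preimage[OF B.open_dom[OF d(1)]]] by metis
  have Y: "pf r (Y r) d = (\<Sum>i\<in>Basis. (Y r c \<bullet> i) *\<^sub>R frechet_derivative ?F (at (crd c r)) i)"
    if r: "r \<in> dom_chart c" "f r \<in> dom_chart d" for r
  proof -
    note m = differentiable_pt_coordinates[OF A.in_carrier[OF c(1) r(1)] d(1) r(2)]
    note l = has_derivative_linear[OF A.differentiable_pt_has_derivative[OF m c(1) r(1)]]
    have "pf r (Y r) d = frechet_derivative ?F (at (crd c r)) (Y r c)"
      by (simp add: pushforward_chart[OF d(1) r(2)]
          A.dirderiv_chart[OF m c(1) r(1) A.vector_field_tangent[OF assms(2)]])
    also have "\<dots> = frechet_derivative ?F (at (crd c r)) (\<Sum>i\<in>Basis. (Y r c \<bullet> i) *\<^sub>R i)"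
      by (simp add: euclidean_representation)
    finally show ?thesis by (simp add: linear_sum[OF l] linear_scale[OF l])
  qed
  have "smooth_on ?S ((\<lambda>r. pf r (Y r) d) \<circ> crd_inv c)"
    unfolding smooth_on_def
  proof
    fix k
    have "Ck_on (Suc k) ?S ?F"
      using smooth_coordinates[OF c(1) d(1)] unfolding smooth_on_def by blast
    note F = Ck_on_SucD(2)[OF this]
    have "Ck_on k ?S ((\<lambda>r. Y r c) \<circ> crd_inv c)"
      by (rule Ck_on_subset[OF A.vector_field_Ck[OF assms(2) c(1)]]) blast
    from Ck_on_inner[OF S this]
    have "Ck_on k ?S (\<lambda>x. \<Sum>i\<in>Basis. (Y (crd_inv c x) c \<bullet> i) *\<^sub>R frechet_derivative ?F (at x) i)"
      by (intro Ck_on_sum[OF S] Ck_on_scaleR[OF S] F) (simp add: o_def)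
    then show "Ck_on k ?S ((\<lambda>r. pf r (Y r) d) \<circ> crd_inv c)"
      by (rule Ck_on_cong[OF S, rotated]) (use A.crd_inv_crd[OF c(1)] Y in auto)
  qed
  then show "differentiable_pt A (\<lambda>r. pf r (Y r) d) p"
    by (rule A.differentiable_pt_chartI[OF c]) (use c d in auto)
qed

end

locale map_into_conn = manifold_map A B f + B: affine_conn B nabla
  for A :: "('m::{t2_space, second_countable_topology}, 'e::euclidean_space) chart set"
    and B :: "('n::{t2_space, second_countable_topology}, 'f::euclidean_space) chart set"
    and f :: "'m \<Rightarrow> 'n" and nabla :: "('n, 'f) connection"
begin

text \<open>If \<open>V = \<Sum> V\<^sup>i E\<^sub>i\<close> near \<open>p\<close>, then \<open>\<nabla>\<^sub>v V = \<Sum> dV\<^sup>i(v) E\<^sub>i + V\<^sup>i \<nabla>\<^sub>X E\<^sub>i\<close>. The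
  definition of \<open>cov_along\<close> assembles chart expressions, while the right-hand side is built from values
  of global vector fields. So this identity replaces the transformation law of the Christoffel
  symbols: it shows at once that the expressions in the various charts fit together to a tangent
  vector.\<close>

lemma cov_along_frame:
  assumes "diff_section V p" "v \<in> tangent_space A p"
    and "B.is_frame d N E" "f p \<in> N" "vector_field B X" "X (f p) = pf p v"
  shows "cov_along A B nabla f V p v = (\<Sum>i\<in>Basis.
    tscale (dirderiv A (\<lambda>r. V r d) p v \<bullet> i) (E i (f p)) +
    tscale (V p d \<bullet> i) (nabla X (E i) (f p)))"
proof (rule ext)
  fix e
  note F = B.is_frameD[OF assms(3)]
  note V = diff_sectionD[OF assms(1)]
  have d: "f p \<in> dom_chart d" using F(3) assms(4) by blast
  let ?G = "christoffel B nabla e (f p) (pf p v e)"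
  show "cov_along A B nabla f V p v e = (\<Sum>i\<in>Basis.
    tscale (dirderiv A (\<lambda>r. V r d) p v \<bullet> i) (E i (f p)) +
    tscale (V p d \<bullet> i) (nabla X (E i) (f p))) e"
  proof (cases "e \<in> B \<and> f p \<in> dom_chart e")
    case False
    then show ?thesis
      using B.tangent_outside[OF B.vector_field_tangent[OF F(4)] False]
        B.tangent_outside[OF B.vector_field_tangent[OF B.nabla_field[OF assms(5) F(4)]] False]
      by (auto simp: cov_along_def)
  next
    case True
    then have e: "e \<in> B" "f p \<in> dom_chart e" by auto
    obtain W where W: "open W" "p \<in> W" "\<And>r. r \<in> W \<Longrightarrow> V r \<in> tangent_space B (f r)"
      "\<And>r. r \<in> W \<Longrightarrow> f r \<in> N"
      using diff_section_near[OF assms(1) F(2) assms(4)] by blast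
    have rep: "(\<Sum>i\<in>Basis. (V r d \<bullet> i) *\<^sub>R E i (f r) e) = V r e" if "r \<in> W" for r
      using fun_cong[OF B.frame_representation[OF assms(3) W(4)[OF that] W(3)[OF that], symmetric], of e]
      by simp
    \<comment> \<open>The frame belongs to the chart \<open>d\<close>, but \<open>V\<close> is differentiated in an arbitrary chart \<open>e\<close>.\<close>
    have "has_dirderiv A p (\<lambda>r. \<Sum>i\<in>Basis. (V r d \<bullet> i) *\<^sub>R E i (f r) e)
      (\<lambda>v. \<Sum>i\<in>Basis. (V p d \<bullet> i) *\<^sub>R dirderiv B (\<lambda>s. E i s e) (f p) (pf p v)
        + (dirderiv A (\<lambda>r. V r d) p v \<bullet> i) *\<^sub>R E i (f p) e)"
      by (intro A.has_dirderiv_sum[OF V(1)]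
          A.has_dirderiv_bilinear[OF V(1) bounded_bilinear_scaleR]
          A.dirderiv_coordinate[OF V(1) V(3)] chain_rule[OF V(1)]
          B.vector_field_differentiable_pt[OF F(4)] F(1) d e)
    from A.has_dirderiv_dirderiv[OF A.has_dirderiv_cong[OF V(1) W(1,2) rep this] assms(2)]
    have "dirderiv A (\<lambda>r. V r e) p v =
      (\<Sum>i\<in>Basis. (V p d \<bullet> i) *\<^sub>R dirderiv B (\<lambda>s. E i s e) (f p) (pf p v)
        + (dirderiv A (\<lambda>r. V r d) p v \<bullet> i) *\<^sub>R E i (f p) e)" by simp
    moreover have "?G (V p e) = (\<Sum>i\<in>Basis. (V p d \<bullet> i) *\<^sub>R ?G (E i (f p) e))"
      unfolding rep[OF W(2), symmetric]
      using B.christoffel_linear[OF e] by (simp add: linear_sum linear_scale)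
    moreover have "nabla X (E i) (f p) e = dirderiv B (\<lambda>s. E i s e) (f p) (pf p v) + ?G (E i (f p) e)"
      for i
      using B.nabla_local_formula[OF e assms(5) F(4)] assms(6) by simp
    ultimately show ?thesis
      using True by (simp add: cov_along_def sum.distrib scaleR_add_right algebra_simps)
  qed
qed

lemma cov_along_tangent:
  assumes "diff_section V p" "v \<in> tangent_space A p"
  shows "cov_along A B nabla f V p v \<in> tangent_space B (f p)"
proof -
  note V = diff_sectionD[OF assms(1)]
  obtain d where d: "d \<in> B" "f p \<in> dom_chart d" using f_carrier[OF V(1)] by (rule B.carrierE)
  obtain N E where E: "f p \<in> N" "B.is_frame d N E" by (rule B.frame_exists[OF d])
  obtain X where X: "vector_field B X" "X (f p) = pf p v"
    by (rule B.vector_field_extending[OF pushforward_tangent[OF V(1) assms(2)]])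
  note F = B.is_frameD[OF E(2)]
  show ?thesis
    unfolding cov_along_frame[OF assms E(2,1) X]
    by (intro B.tangent_sum B.tangent_add B.tangent_scale B.vector_field_tangent F X B.nabla_field)
qed

end

section \<open>Metrics\<close>

locale riemannian = smooth_atlas A
  for A :: "('m::{t2_space, second_countable_topology}, 'e::euclidean_space) chart set" +
  fixes g :: "('m, 'e) metric"
  assumes metric: "riemannian_metric A g"
begin

lemma
  assumes "p \<in> carrier_of A" "u \<in> tangent_space A p" "v \<in> tangent_space A p"
  shows g_add_left: "\<And>w. w \<in> tangent_space A p \<Longrightarrow> g p (u + v) w = g p u w + g p v w"
    and g_scale_left: "\<And>a. g p (tscale a u) v = a * g p u v"
    and g_sym: "g p u v = g p v u"
    and g_pos: "u \<noteq> 0 \<Longrightarrow> g p u u > 0"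
  using metric assms unfolding riemannian_metric_def by blast+

lemma g_add_right:
  assumes "p \<in> carrier_of A" "u \<in> tangent_space A p" "v \<in> tangent_space A p" "w \<in> tangent_space A p"
  shows "g p w (u + v) = g p w u + g p w v"
  using assms g_sym[OF assms(1,4)] g_add_left[OF assms] by (simp add: tangent_add)

lemma g_scale_right:
  assumes "p \<in> carrier_of A" "u \<in> tangent_space A p" "v \<in> tangent_space A p"
  shows "g p v (tscale a u) = a * g p v u"
  using assms g_sym[OF assms(1,3)] g_scale_left[OF assms] by (simp add: tangent_scale)

lemma g_diff_left:
  assumes "p \<in> carrier_of A" "u \<in> tangent_space A p" "v \<in> tangent_space A p" "w \<in> tangent_space A p"
  shows "g p (u - v) w = g p u w - g p v w"
  using g_add_left[OF assms(1,2) tangent_scale[OF assms(3), of "- 1"] assms(4)]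
    g_scale_left[OF assms(1,3,4), of "- 1"]
  by (simp add: uminus_tscale[symmetric])

lemma g_0_left:
  assumes "p \<in> carrier_of A" "w \<in> tangent_space A p"
  shows "g p 0 w = 0"
  using g_add_left[OF assms(1) tangent_0 tangent_0 assms(2)] by simp

lemma g_0_right:
  assumes "p \<in> carrier_of A" "w \<in> tangent_space A p"
  shows "g p w 0 = 0"
  using g_add_right[OF assms(1) tangent_0 tangent_0 assms(2)] by simp

lemma g_sum_left:
  assumes "p \<in> carrier_of A" "w \<in> tangent_space A p" "\<And>i. i \<in> I \<Longrightarrow> F i \<in> tangent_space A p"
  shows "g p (\<Sum>i\<in>I. F i) w = (\<Sum>i\<in>I. g p (F i) w)"
  using assms(3)
  by (induction I rule: infinite_finite_induct)
    (simp_all add: g_0_left g_add_left tangent_sum assms(1,2))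

lemma g_sum_right:
  assumes "p \<in> carrier_of A" "w \<in> tangent_space A p" "\<And>i. i \<in> I \<Longrightarrow> F i \<in> tangent_space A p"
  shows "g p w (\<Sum>i\<in>I. F i) = (\<Sum>i\<in>I. g p w (F i))"
  using assms(3)
  by (induction I rule: infinite_finite_induct)
    (simp_all add: g_0_right g_add_right tangent_sum assms(1,2))

lemma g_eq_0_imp:
  assumes "p \<in> carrier_of A" "u \<in> tangent_space A p" "g p u u = 0"
  shows "u = 0"
  using g_pos[OF assms(1,2,2)] assms(3) by fastforce

lemma g_smooth:
  "vector_field A X \<Longrightarrow> vector_field A Y \<Longrightarrow> smooth_fun A (\<lambda>p. g p (X p) (Y p))"
  using metric by (simp add: riemannian_metric_def)

end

locale metric_conn = riemannian A g + affine_conn A nabla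
  for A :: "('m::{t2_space, second_countable_topology}, 'e::euclidean_space) chart set"
    and g :: "('m, 'e) metric" and nabla :: "('m, 'e) connection" +
  assumes cov_metric_0: "vector_field A X \<Longrightarrow> vector_field A Y \<Longrightarrow> vector_field A Z \<Longrightarrow>
    p \<in> carrier_of A \<Longrightarrow> cov_metric A nabla g X Y Z p = 0"
begin

lemma compatible:
  assumes "vector_field A X" "vector_field A Y" "vector_field A Z" "p \<in> carrier_of A"
  shows "dirderiv A (\<lambda>q. g q (Y q) (Z q)) p (X p) = g p (nabla X Y p) (Z p) + g p (Y p) (nabla X Z p)"
  using cov_metric_0[OF assms] by (simp add: cov_metric_def)

end

locale map_into_metric_conn = map_into_conn A B f nabla + B: metric_conn B g nabla
  for A :: "('m::{t2_space, second_countable_topology}, 'e::euclidean_space) chart set"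
    and B :: "('n::{t2_space, second_countable_topology}, 'f::euclidean_space) chart set"
    and f :: "'m \<Rightarrow> 'n" and g :: "('n, 'f) metric" and nabla :: "('n, 'f) connection"
begin

text \<open>Metric compatibility is known for global fields on the target. It is transferred to sections along
  \<open>f\<close> by expanding them in a frame, one argument of the metric at a time: here the second argument is
  still the restriction of a global field, and in the next lemma it is expanded as well.\<close>

lemma compatible_with_field:
  assumes "diff_section V p" "vector_field B Z"
  shows "differentiable_pt A (\<lambda>r. g (f r) (V r) (Z (f r))) p"
    and "\<And>v X. v \<in> tangent_space A p \<Longrightarrow> vector_field B X \<Longrightarrow> X (f p) = pf p v \<Longrightarrow>
      dirderiv A (\<lambda>r. g (f r) (V r) (Z (f r))) p v =
        g (f p) (cov_along A B nabla f V p v) (Z (f p)) + g (f p) (V p) (nabla X Z (f p))"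
proof -
  note V = diff_sectionD[OF assms(1)]
  note q = f_carrier[OF V(1)]
  obtain d where d: "d \<in> B" "f p \<in> dom_chart d" using q by (rule B.carrierE)
  obtain N E where E: "f p \<in> N" "B.is_frame d N E" by (rule B.frame_exists[OF d])
  note F = B.is_frameD[OF E(2)]
  have ET: "E b s \<in> tangent_space B s" and ZT: "Z s \<in> tangent_space B s" for b s
    by (rule B.vector_field_tangent F(4) assms(2))+
  define G where "G i s = g s (E i s) (Z s)" for i s
  have G: "differentiable_pt B (G i) s" if "s \<in> carrier_of B" for i s
    unfolding G_def by (rule B.differentiable_pt_smooth_fun[OF B.g_smooth[OF F(4) assms(2)] that])
  obtain W where W: "open W" "p \<in> W" "\<And>r. r \<in> W \<Longrightarrow> V r \<in> tangent_space B (f r)"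
    "\<And>r. r \<in> W \<Longrightarrow> f r \<in> N"
    using diff_section_near[OF assms(1) F(2) E(1)] by blast
  have rep: "(\<Sum>i\<in>Basis. (V r d \<bullet> i) * G i (f r)) = g (f r) (V r) (Z (f r))" if "r \<in> W" for r
  proof -
    have fr: "f r \<in> carrier_of B" using B.in_carrier[OF F(1)] F(3) W(4)[OF that] by blast
    have "g (f r) (V r) (Z (f r)) = g (f r) (\<Sum>i\<in>Basis. tscale (V r d \<bullet> i) (E i (f r))) (Z (f r))"
      by (rule arg_cong[OF B.frame_representation[OF E(2) W(4)[OF that] W(3)[OF that]]])
    also have "\<dots> = (\<Sum>i\<in>Basis. (V r d \<bullet> i) * G i (f r))"
      by (simp add: B.g_sum_left fr ET ZT B.tangent_scale B.g_scale_left G_def)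
    finally show ?thesis by simp
  qed
  have "has_dirderiv A p (\<lambda>r. \<Sum>i\<in>Basis. (V r d \<bullet> i) * G i (f r))
      (\<lambda>v. \<Sum>i\<in>Basis. (V p d \<bullet> i) * dirderiv B (G i) (f p) (pf p v)
        + (dirderiv A (\<lambda>r. V r d) p v \<bullet> i) * G i (f p))"
    by (intro A.has_dirderiv_sum[OF V(1)]
        A.has_dirderiv_bilinear[OF V(1) bounded_bilinear_mult]
        A.dirderiv_coordinate[OF V(1) V(3)] chain_rule[OF V(1)] G[OF q] d)
  note D = A.has_dirderiv_cong[OF V(1) W(1,2) rep this]
  then show "differentiable_pt A (\<lambda>r. g (f r) (V r) (Z (f r))) p" by (simp add: has_dirderiv_def)
  fix v X assume v: "v \<in> tangent_space A p" "vector_field B X" "X (f p) = pf p v"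
  have VT: "V p \<in> tangent_space B (f p)" by (rule V(2))
  have XE: "nabla X (E i) (f p) \<in> tangent_space B (f p)" for i
    by (rule B.vector_field_tangent[OF B.nabla_field[OF v(2) F(4)]])
  have XZ: "nabla X Z (f p) \<in> tangent_space B (f p)"
    by (rule B.vector_field_tangent[OF B.nabla_field[OF v(2) assms(2)]])
  have dG: "dirderiv B (G i) (f p) (pf p v) =
      g (f p) (nabla X (E i) (f p)) (Z (f p)) + g (f p) (E i (f p)) (nabla X Z (f p))" for i
    unfolding G_def v(3)[symmetric] by (rule B.compatible[OF v(2) F(4) assms(2) q])
  have "g (f p) (V p) (nabla X Z (f p)) =
      g (f p) (\<Sum>i\<in>Basis. tscale (V p d \<bullet> i) (E i (f p))) (nabla X Z (f p))"
    by (rule arg_cong[OF B.frame_representation[OF E(2,1) VT]])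
  also have "\<dots> = (\<Sum>i\<in>Basis. (V p d \<bullet> i) * g (f p) (E i (f p)) (nabla X Z (f p)))"
    by (simp add: B.g_sum_left q ET XZ B.tangent_scale B.g_scale_left)
  finally have VZ: "g (f p) (V p) (nabla X Z (f p)) =
      (\<Sum>i\<in>Basis. (V p d \<bullet> i) * g (f p) (E i (f p)) (nabla X Z (f p)))" .
  have CZ: "g (f p) (cov_along A B nabla f V p v) (Z (f p)) =
      (\<Sum>i\<in>Basis. (dirderiv A (\<lambda>r. V r d) p v \<bullet> i) * G i (f p)
        + (V p d \<bullet> i) * g (f p) (nabla X (E i) (f p)) (Z (f p)))"
    unfolding cov_along_frame[OF assms(1) v(1) E(2,1) v(2,3)]
    by (simp add: B.g_sum_left q ET ZT XE B.tangent_add B.tangent_scale B.g_add_left B.g_scale_left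
        G_def)
  show "dirderiv A (\<lambda>r. g (f r) (V r) (Z (f r))) p v =
        g (f p) (cov_along A B nabla f V p v) (Z (f p)) + g (f p) (V p) (nabla X Z (f p))"
    unfolding VZ CZ sum.distrib[symmetric]
    by (rule trans[OF A.has_dirderiv_dirderiv[OF D v(1)] sum.cong])
      (simp_all add: dG algebra_simps)
qed

lemma compatible_along:
  assumes "diff_section V p" "diff_section W p" "v \<in> tangent_space A p"
  shows "dirderiv A (\<lambda>r. g (f r) (V r) (W r)) p v =
    g (f p) (cov_along A B nabla f V p v) (W p) + g (f p) (V p) (cov_along A B nabla f W p v)"
proof -
  note V = diff_sectionD[OF assms(1)] and W = diff_sectionD[OF assms(2)]
  note q = f_carrier[OF V(1)]
  obtain d where d: "d \<in> B" "f p \<in> dom_chart d" using q by (rule B.carrierE)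
  obtain N E where E: "f p \<in> N" "B.is_frame d N E" by (rule B.frame_exists[OF d])
  note F = B.is_frameD[OF E(2)]
  obtain X where X: "vector_field B X" "X (f p) = pf p v"
    by (rule B.vector_field_extending[OF pushforward_tangent[OF V(1) assms(3)]])
  have ET: "E b s \<in> tangent_space B s" for b s
    by (rule B.vector_field_tangent[OF F(4)])
  have XE: "nabla X (E i) (f p) \<in> tangent_space B (f p)" for i
    by (rule B.vector_field_tangent[OF B.nabla_field[OF X(1) F(4)]])
  have CT: "cov_along A B nabla f V p v \<in> tangent_space B (f p)"
    by (rule cov_along_tangent[OF assms(1,3)])
  obtain U1 where U1: "open U1" "p \<in> U1" "\<And>r. r \<in> U1 \<Longrightarrow> V r \<in> tangent_space B (f r)"
    "\<And>r. r \<in> U1 \<Longrightarrow> f r \<in> N"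
    using diff_section_near[OF assms(1) F(2) E(1)] by blast
  obtain U2 where U2: "open U2" "p \<in> U2" "\<And>r. r \<in> U2 \<Longrightarrow> W r \<in> tangent_space B (f r)"
    "\<And>r. r \<in> U2 \<Longrightarrow> f r \<in> N"
    using diff_section_near[OF assms(2) F(2) E(1)] by blast
  have U: "open (U1 \<inter> U2)" "p \<in> U1 \<inter> U2" using U1 U2 by auto
  have rep: "(\<Sum>i\<in>Basis. (W r d \<bullet> i) * g (f r) (V r) (E i (f r))) = g (f r) (V r) (W r)"
    if "r \<in> U1 \<inter> U2" for r
  proof -
    have r: "r \<in> U1" "r \<in> U2" using that by auto
    have fr: "f r \<in> carrier_of B" using B.in_carrier[OF F(1)] F(3) U1(4)[OF r(1)] by blast
    have "g (f r) (V r) (W r) = g (f r) (V r) (\<Sum>i\<in>Basis. tscale (W r d \<bullet> i) (E i (f r)))"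
      by (rule arg_cong[OF B.frame_representation[OF E(2) U2(4)[OF r(2)] U2(3)[OF r(2)]]])
    also have "\<dots> = (\<Sum>i\<in>Basis. (W r d \<bullet> i) * g (f r) (V r) (E i (f r)))"
      by (simp add: B.g_sum_right fr ET U1(3)[OF r(1)] B.tangent_scale B.g_scale_right)
    finally show ?thesis by simp
  qed
  have "has_dirderiv A p (\<lambda>r. \<Sum>i\<in>Basis. (W r d \<bullet> i) * g (f r) (V r) (E i (f r)))
      (\<lambda>v. \<Sum>i\<in>Basis. (W p d \<bullet> i) * dirderiv A (\<lambda>r. g (f r) (V r) (E i (f r))) p v
        + (dirderiv A (\<lambda>r. W r d) p v \<bullet> i) * g (f p) (V p) (E i (f p)))"
    by (intro A.has_dirderiv_sum[OF V(1)]
        A.has_dirderiv_bilinear[OF V(1) bounded_bilinear_mult]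
        A.dirderiv_coordinate[OF V(1) W(3)] has_dirderiv_differentiable_pt
        compatible_with_field(1)[OF assms(1) F(4)] d)
  note D = A.has_dirderiv_cong[OF V(1) U rep this]
  have "g (f p) (cov_along A B nabla f V p v) (W p) =
      g (f p) (cov_along A B nabla f V p v) (\<Sum>i\<in>Basis. tscale (W p d \<bullet> i) (E i (f p)))"
    by (rule arg_cong[OF B.frame_representation[OF E(2,1) W(2)]])
  also have "\<dots> = (\<Sum>i\<in>Basis. (W p d \<bullet> i) * g (f p) (cov_along A B nabla f V p v) (E i (f p)))"
    by (simp add: B.g_sum_right q ET CT B.tangent_scale B.g_scale_right)
  finally have CW: "g (f p) (cov_along A B nabla f V p v) (W p) =
      (\<Sum>i\<in>Basis. (W p d \<bullet> i) * g (f p) (cov_along A B nabla f V p v) (E i (f p)))" .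
  have VC: "g (f p) (V p) (cov_along A B nabla f W p v) =
      (\<Sum>i\<in>Basis. (dirderiv A (\<lambda>r. W r d) p v \<bullet> i) * g (f p) (V p) (E i (f p))
        + (W p d \<bullet> i) * g (f p) (V p) (nabla X (E i) (f p)))"
    unfolding cov_along_frame[OF assms(2,3) E(2,1) X]
    by (simp add: B.g_sum_right q ET V(2) XE B.tangent_add B.tangent_scale B.g_add_right
        B.g_scale_right)
  show ?thesis
    unfolding VC CW sum.distrib[symmetric]
    by (rule trans[OF A.has_dirderiv_dirderiv[OF D assms(3)] sum.cong])
      (simp_all add: compatible_with_field(2)[OF assms(1) F(4) assms(3) X] algebra_simps)
qed

end

section \<open>The difference tensor\<close>

text \<open>A statistical structure together with the Levi-Civita connection of its metric, and the difference
  of the two connections. The cubic form \<open>g (K X Y) Z\<close> carries the whole deviation of the structure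
  from the Riemannian one.\<close>

locale statistical_pair = riemannian A g + S: affine_conn A nabla + L: metric_conn A g nabla0
  for A :: "('m::{t2_space, second_countable_topology}, 'e::euclidean_space) chart set"
    and g :: "('m, 'e) metric" and nabla nabla0 :: "('m, 'e) connection" +
  assumes torsion_free: "torsion_free A nabla" "torsion_free A nabla0"
    and codazzi: "vector_field A X \<Longrightarrow> vector_field A Y \<Longrightarrow> vector_field A Z \<Longrightarrow>
      p \<in> carrier_of A \<Longrightarrow> cov_metric A nabla g X Y Z p = cov_metric A nabla g Y X Z p"
begin

definition K :: "('m, 'e) connection" where "K X Y = nabla X Y - nabla0 X Y"

lemma nabla_eq: "nabla X Y = nabla0 X Y + K X Y"
  by (simp add: K_def)

lemma K_field: "vector_field A X \<Longrightarrow> vector_field A Y \<Longrightarrow> vector_field A (K X Y)"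
  unfolding K_def by (intro vector_field_diff S.nabla_field L.nabla_field)

lemma K_commute:
  assumes "vector_field A X" "vector_field A Y"
  shows "K X Y = K Y X"
proof -
  have "nabla X Y - nabla Y X = nabla0 X Y - nabla0 Y X"
    using torsion_free assms by (simp add: torsion_free_def)
  then have "nabla X Y - nabla0 X Y = nabla Y X - nabla0 Y X"
    by (simp add: algebra_simps)
  then show ?thesis by (simp add: K_def)
qed

text \<open>For the Levi-Civita connection \<open>\<nabla>g\<close> vanishes, so
  \<open>(\<nabla>\<^sub>X g)(Y, Z) = - g(K\<^sub>X Y, Z) - g(Y, K\<^sub>X Z)\<close>. The Codazzi equation and the symmetry of \<open>K\<close>, a
  consequence of the vanishing torsions, make the cubic form totally symmetric.\<close>

lemma K_symmetric:
  assumes "vector_field A X" "vector_field A Y" "vector_field A Z" "p \<in> carrier_of A"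
  shows "g p (K X Y p) (Z p) = g p (K X Z p) (Y p)"
proof -
  have T: "U p \<in> tangent_space A p" if "vector_field A U" for U
    by (rule vector_field_tangent[OF that])
  have *: "cov_metric A nabla g U V W p = - g p (K U V p) (W p) - g p (V p) (K U W p)"
    if "vector_field A U" "vector_field A V" "vector_field A W" for U V W
    using L.compatible[OF that assms(4)] that
    by (simp add: cov_metric_def nabla_eq g_add_left g_add_right T K_field L.nabla_field assms(4))
  have "g p (K X Y p) (Z p) = g p (K Y X p) (Z p)"
    by (simp add: K_commute assms)
  also have "\<dots> = g p (K Z X p) (Y p)"
    using codazzi[OF assms(2,3,1,4)] assms
    by (simp add: * K_commute[of Z Y] g_sym[OF assms(4)] T K_field)
  finally show ?thesis by (simp add: K_commute assms)
qed

lemma K_tensor: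
  assumes "vector_field A X" "vector_field A X'" "vector_field A Y" "vector_field A Y'"
    and "p \<in> carrier_of A" "X p = X' p" "Y p = Y' p"
  shows "K X Y p = K X' Y' p"
proof -
  have *: "K U V p = K U' V p"
    if "vector_field A U" "vector_field A U'" "vector_field A V" "U p = U' p" for U U' V
    using S.nabla_tensor_left[OF assms(5) that] L.nabla_tensor_left[OF assms(5) that]
    by (simp add: K_def)
  show ?thesis
    using *[OF assms(1,2,3,6)] *[OF assms(3,4,2,7)] by (simp add: K_commute assms)
qed

lemma lie_bracket_field:
  assumes "vector_field A X" "vector_field A Y"
  shows "vector_field A (lie_bracket A X Y)"
proof -
  have "lie_bracket A X Y = nabla0 X Y - nabla0 Y X"
    using torsion_free(2) assms by (simp add: torsion_free_def)
  then show ?thesis using assms by (simp add: vector_field_diff L.nabla_field)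
qed

text \<open>The part of \<open>g(\<nabla>\<^sub>X(K\<^sub>Y Z), W)\<close> that is skew in \<open>Z, W\<close>: the derivative of \<open>g(K\<^sub>Y Z, W)\<close> cancels by
  symmetry, and only first-order terms remain.\<close>

lemma g_nabla0_K:
  assumes "vector_field A X" "vector_field A Y" "vector_field A Z" "vector_field A W" "p \<in> carrier_of A"
  shows "g p (nabla0 X (K Y Z) p) (W p) - g p (nabla0 X (K Y W) p) (Z p) =
    g p (K Y W p) (nabla0 X Z p) - g p (K Y Z p) (nabla0 X W p)"
proof -
  have "dirderiv A (\<lambda>q. g q (K Y Z q) (W q)) p (X p) = dirderiv A (\<lambda>q. g q (K Y W q) (Z q)) p (X p)"
    by (rule dirderiv_cong[OF assms(5) open_carrier assms(5) K_symmetric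
          differentiable_pt_smooth_fun[OF g_smooth]])
      (use assms in \<open>simp_all add: K_field vector_field_tangent\<close>)
  then show ?thesis
    using L.compatible[OF assms(1) K_field[OF assms(2,3)] assms(4,5)]
      L.compatible[OF assms(1) K_field[OF assms(2,4)] assms(3,5)] by simp
qed

text \<open>Substitute \<open>\<nabla> = \<nabla>\<^sup>0 + K\<close> in the curvature of \<open>\<nabla>\<close>.\<close>

lemma curvature_difference:
  assumes "vector_field A X" "vector_field A Y" "vector_field A Z" "vector_field A W" "p \<in> carrier_of A"
  shows "g p (curvature A nabla X Y Z p) (W p) - g p (curvature A nabla0 X Y Z p) (W p) =
    (g p (nabla0 X (K Y Z) p) (W p) + g p (K X (nabla0 Y Z) p) (W p) + g p (K X (K Y Z) p) (W p))
    - (g p (nabla0 Y (K X Z) p) (W p) + g p (K Y (nabla0 X Z) p) (W p) + g p (K Y (K X Z) p) (W p))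
    - g p (K (lie_bracket A X Y) Z p) (W p)"
proof -
  have T: "U p \<in> tangent_space A p" if "vector_field A U" for U
    by (rule vector_field_tangent[OF that])
  have two: "nabla U (nabla V Z) p =
      nabla0 U (nabla0 V Z) p + nabla0 U (K V Z) p + K U (nabla0 V Z) p + K U (K V Z) p"
    if "vector_field A U" "vector_field A V" for U V
  proof -
    have "nabla U (nabla V Z) p = nabla U (nabla0 V Z) p + nabla U (K V Z) p"
      unfolding nabla_eq[of V] using that assms(3)
      by (intro S.nabla_add_right K_field L.nabla_field)
    then show ?thesis by (simp add: nabla_eq algebra_simps)
  qed
  show ?thesis
    unfolding curvature_def
    by (simp add: two assms) (simp add: nabla_eq[of "lie_bracket A X Y"] g_add_left g_diff_left T tangent_add tangent_diff
        K_field L.nabla_field assms lie_bracket_field)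
qed

text \<open>The identity \<open>[K\<^sub>X, K\<^sub>Y] Z = (k - k0) (g(Y, Z) X - g(X, Z) Y)\<close>, paired with \<open>W\<close>. In the formula for
  the difference of the curvatures, pass to the part that is skew in \<open>Z, W\<close>. The covariant
  derivative of \<open>K\<close> is symmetric in \<open>Z, W\<close> and drops out; the commutator term and, for constant
  curvatures, the left-hand side are already skew.\<close>

lemma K_commutator:
  assumes "constant_curvature A nabla g k" "constant_curvature A nabla0 g k0"
    and "vector_field A X" "vector_field A Y" "vector_field A Z" "vector_field A W" "p \<in> carrier_of A"
  shows "g p (K Y Z p) (K X W p) - g p (K X Z p) (K Y W p) =
    (k - k0) * (g p (Y p) (Z p) * g p (X p) (W p) - g p (X p) (Z p) * g p (Y p) (W p))"
proof -
  have T: "U p \<in> tangent_space A p" if "vector_field A U" for U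
    by (rule vector_field_tangent[OF that])
  have R: "g p (curvature A nabla X Y Z p) (W p) - g p (curvature A nabla0 X Y Z p) (W p) =
      (k - k0) * (g p (Y p) (Z p) * g p (X p) (W p) - g p (X p) (Z p) * g p (Y p) (W p))"
    if "vector_field A Z" "vector_field A W" for Z W
    using assms that
    by (simp add: constant_curvature_def g_scale_left g_diff_left T tangent_scale tangent_diff algebra_simps)
  \<comment> \<open>\<open>R2\<close> is \<open>R1\<close> with \<open>Z\<close> and \<open>W\<close> exchanged; the result is half the difference of the two.\<close>
  note R1 = R[OF assms(5,6), unfolded curvature_difference[OF assms(3-7)]]
    and R2 = R[OF assms(6,5), unfolded curvature_difference[OF assms(3,4,6,5,7)]]
  have Kg: "g p (K U V p) (V' p) = g p (K U V' p) (V p)"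
    if "vector_field A U" "vector_field A V" "vector_field A V'" for U V V'
    by (rule K_symmetric[OF that assms(7)])
  have s: "g p (U p) (V p) = g p (V p) (U p)" if "vector_field A U" "vector_field A V" for U V
    by (rule g_sym[OF assms(7) T[OF that(1)] T[OF that(2)]])
  note f = K_field L.nabla_field lie_bracket_field assms(3-6)
  note N1 = g_nabla0_K[OF assms(3-7)] and N2 = g_nabla0_K[OF assms(4,3,5,6,7)]
  have e: "g p (K X (nabla0 Y Z) p) (W p) = g p (K X W p) (nabla0 Y Z p)"
    "g p (K X (nabla0 Y W) p) (Z p) = g p (K X Z p) (nabla0 Y W p)"
    "g p (K Y (nabla0 X Z) p) (W p) = g p (K Y W p) (nabla0 X Z p)"
    "g p (K Y (nabla0 X W) p) (Z p) = g p (K Y Z p) (nabla0 X W p)"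
    "g p (K X (K Y Z) p) (W p) = g p (K Y Z p) (K X W p)"
    "g p (K X (K Y W) p) (Z p) = g p (K X Z p) (K Y W p)"
    "g p (K Y (K X Z) p) (W p) = g p (K X Z p) (K Y W p)"
    "g p (K Y (K X W) p) (Z p) = g p (K Y Z p) (K X W p)"
    "g p (K (lie_bracket A X Y) Z p) (W p) = g p (K (lie_bracket A X Y) W p) (Z p)"
    by (simp_all only: f Kg[of X _ W] Kg[of X _ Z] Kg[of Y _ W] Kg[of Y _ Z] Kg[of "lie_bracket A X Y" _ W]
        s[of "K Y Z" "K X W"] s[of "K Y W" "K X Z"])
  show ?thesis
    using R1 R2 N1 N2 unfolding e by (simp only: right_diff_distrib mult.commute[of _ "g p (X p) _"])
qed

end

section \<open>Hypersurfaces\<close>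

lemma nontrivial_kernel:
  fixes \<psi> :: "'e::euclidean_space \<Rightarrow> real"
  assumes "linear \<psi>" "DIM('e) \<ge> 2"
  obtains b where "b \<noteq> 0" "\<psi> b = 0"
proof -
  have "\<not> inj \<psi>"
  proof
    assume "inj \<psi>"
    then have "dim (range \<psi>) = DIM('e)"
      using dim_image_eq[OF assms(1), of UNIV] by simp
    then show False using dim_subset_UNIV[of "range \<psi>"] assms(2) by simp
  qed
  then show thesis
    using that linear_injective_0[OF assms(1)] by blast
qed

text \<open>The range of \<open>L\<close> has codimension one, so adjoining any vector outside it already gives the full
  dimension.\<close>

lemma range_hyperplane_complement:
  fixes L :: "'e::euclidean_space \<Rightarrow> 'f::euclidean_space"
  assumes "linear L" "inj L" "DIM('f) = DIM('e) + 1" "x \<notin> range L"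
  obtains a t where "y = L a + t *\<^sub>R x"
proof -
  have s: "span (range L) = range L"
    using linear_subspace_image[OF assms(1) subspace_UNIV] by (simp add: span_eq_iff)
  have "dim (range L) = DIM('e)"
    using dim_image_eq[OF assms(1), of UNIV] assms(2) by simp
  then have "dim (insert x (range L)) = DIM('f)"
    using assms(3,4) by (simp only: dim_insert s if_False)
  then have "y \<in> span (insert x (range L))"
    by (simp add: dim_eq_full)
  then obtain t where "y - t *\<^sub>R x \<in> range L"
    by (auto simp only: span_breakdown_eq s)
  then obtain a where "y - t *\<^sub>R x = L a" by blast
  then have "y = L a + t *\<^sub>R x" by (simp add: algebra_simps)
  then show thesis by (rule that)
qed

locale hypersurface =
  fixes A :: "('m::{t2_space, second_countable_topology}, 'e::euclidean_space) chart set"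
    and nabla :: "('m, 'e) connection" and g :: "('m, 'e) metric"
    and B :: "('n::{t2_space, second_countable_topology}, 'f::euclidean_space) chart set"
    and nabla' nabla0' :: "('n, 'f) connection" and g' :: "('n, 'f) metric"
    and f :: "'m \<Rightarrow> 'n"
  assumes trivial_M: "trivial_statistical_manifold A nabla g"
    and statistical_M': "statistical_manifold B nabla' g'"
    and levi_civita_M': "levi_civita B nabla0' g'"
    and immersion_f: "statistical_immersion A nabla g B nabla' g' f"
    and codim: "DIM('f) = DIM('e) + 1"
begin

sublocale M: metric_conn A g nabla
  using trivial_M
  by unfold_locales (simp_all add: trivial_statistical_manifold_def statistical_manifold_def levi_civita_def)

sublocale M': statistical_pair B g' nabla' nabla0'
  using statistical_M' levi_civita_M'
  by unfold_locales (simp_all add: statistical_manifold_def levi_civita_def)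

sublocale S: map_into_conn A B f nabla'
  using immersion_f by unfold_locales (simp add: statistical_immersion_def immersion_def)

sublocale L: map_into_metric_conn A B f g' nabla0'
  by unfold_locales

abbreviation "pf \<equiv> pushforward A B f"
abbreviation "cov \<equiv> cov_along A B nabla' f"
abbreviation "cov0 \<equiv> cov_along A B nabla0' f"
abbreviation "K \<equiv> M'.K"

text \<open>\<open>christoffel\<close> chooses the same auxiliary fields for both connections, so the difference of the
  Christoffel terms is \<open>K\<close> evaluated on these fields, and \<open>K\<close> is tensorial.\<close>

lemma cov_difference:
  assumes "S.diff_section V p" "v \<in> tangent_space A p"
    and "vector_field B X" "X (f p) = pf p v" "vector_field B Y" "Y (f p) = V p"
  shows "cov V p v = cov0 V p v + K X Y (f p)"
proof -
  note V = S.diff_sectionD[OF assms(1)]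
  note q = S.f_carrier[OF V(1)]
  obtain d where d: "d \<in> B" "f p \<in> dom_chart d" using q by (rule M'.carrierE)
  obtain N E where E: "f p \<in> N" "M'.is_frame d N E" by (rule M'.frame_exists[OF d])
  note F = M'.is_frameD[OF E(2)]
  have eq: "E (V p d) (f p) = Y (f p)"
    using F(5)[OF E(1)] M'.tvec_of_tangent_eq[OF V(2) d] assms(6) by simp
  have c: "christoffel B nabla' d (f p) (pf p v d) (V p d) = nabla' X (E (V p d)) (f p) d"
    "christoffel B nabla0' d (f p) (pf p v d) (V p d) = nabla0' X (E (V p d)) (f p) d"
    using M'.S.christoffel_frame[OF E(2,1) assms(3)] M'.L.christoffel_frame[OF E(2,1) assms(3)]
    by (simp_all add: assms(4))
  have "cov V p v d = cov0 V p v d + K X (E (V p d)) (f p) d"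
    using d by (simp add: cov_along_def c M'.K_def)
  also have "K X (E (V p d)) (f p) = K X Y (f p)"
    by (rule M'.K_tensor[OF assms(3,3) F(4) assms(5) q refl eq])
  finally have "cov V p v d = (cov0 V p v + K X Y (f p)) d" by simp
  then show ?thesis
    by (intro M'.tangent_eqI[OF _ _ d] S.cov_along_tangent[OF assms(1,2)] M'.tangent_add
        L.cov_along_tangent[OF assms(1,2)] M'.vector_field_tangent M'.K_field assms)
qed

text \<open>The connection induced on \<open>M\<close> by the Levi-Civita connection of the ambient space is compatible with
  \<open>g\<close>, and so is \<open>nabla\<close>, since \<open>M\<close> is trivial. The two differ by the cubic form on tangential
  vectors. Taking the difference of the two compatibility equations shows that the cubic form is
  skew in its last two arguments; being also symmetric in them, it vanishes.\<close>

lemma K_tangential: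
  assumes "p \<in> carrier_of A" "x \<in> tangent_space A p" "y \<in> tangent_space A p" "z \<in> tangent_space A p"
    and "vector_field B X" "vector_field B Y" "vector_field B Z"
    and "X (f p) = pf p x" "Y (f p) = pf p y" "Z (f p) = pf p z"
  shows "g' (f p) (K X Y (f p)) (Z (f p)) = 0"
proof -
  note q = S.f_carrier[OF assms(1)]
  obtain X0 where X0: "vector_field A X0" "X0 p = x" by (rule M.vector_field_extending[OF assms(2)])
  obtain Y0 where Y0: "vector_field A Y0" "Y0 p = y" by (rule M.vector_field_extending[OF assms(3)])
  obtain Z0 where Z0: "vector_field A Z0" "Z0 p = z" by (rule M.vector_field_extending[OF assms(4)])
  note T = M'.vector_field_tangent and TA = M.vector_field_tangent
  let ?Y = "\<lambda>r. pf r (Y0 r)" and ?Z = "\<lambda>r. pf r (Z0 r)"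
  note sY = S.diff_section_pushforward[OF assms(1) Y0(1)]
    and sZ = S.diff_section_pushforward[OF assms(1) Z0(1)]
  have isometric: "g r u v = g' (f r) (pf r u) (pf r v)"
    if "r \<in> carrier_of A" "u \<in> tangent_space A r" "v \<in> tangent_space A r" for r u v
    using immersion_f that unfolding statistical_immersion_def by blast
  have induced: "g p (nabla X0 V p) (W p) = g' (f p) (cov (\<lambda>r. pf r (V r)) p x) (pf p (W p))"
    if "vector_field A V" "vector_field A W" for V W
    using immersion_f that X0(1) assms(1) by (simp add: statistical_immersion_def flip: X0(2))
  have cY: "cov ?Y p x = cov0 ?Y p x + K X Y (f p)"
    by (rule cov_difference[OF sY assms(2) assms(5,8,6)]) (simp add: assms(9) Y0)
  have cZ: "cov ?Z p x = cov0 ?Z p x + K X Z (f p)"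
    by (rule cov_difference[OF sZ assms(2) assms(5,8,7)]) (simp add: assms(10) Z0)
  note C = L.cov_along_tangent[OF sY assms(2)] L.cov_along_tangent[OF sZ assms(2)]
  note KT = T[OF M'.K_field[OF assms(5,6)], of "f p"] T[OF M'.K_field[OF assms(5,7)], of "f p"]
  have 1: "g p (nabla X0 Y0 p) z = g' (f p) (cov0 ?Y p x) (Z (f p)) + g' (f p) (K X Y (f p)) (Z (f p))"
    using induced[OF Y0(1) Z0(1)] cY M'.g_add_left[OF q C(1) KT(1) T[OF assms(7)]]
    by (simp add: Z0 assms(10))
  have 2: "g p (nabla X0 Z0 p) y = g' (f p) (cov0 ?Z p x) (Y (f p)) + g' (f p) (K X Z (f p)) (Y (f p))"
    using induced[OF Z0(1) Y0(1)] cZ M'.g_add_left[OF q C(2) KT(2) T[OF assms(6)]]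
    by (simp add: Y0 assms(9))
  have "dirderiv A (\<lambda>r. g r (Y0 r) (Z0 r)) p x =
      dirderiv A (\<lambda>r. g' (f r) (pf r (Y0 r)) (pf r (Z0 r))) p x"
    by (rule M.dirderiv_cong[OF assms(1) M.open_carrier assms(1) isometric
          M.differentiable_pt_smooth_fun[OF M.g_smooth[OF Y0(1) Z0(1)] assms(1)] assms(2)])
      (simp_all add: TA Y0 Z0)
  also have "\<dots> = g' (f p) (cov0 ?Y p x) (Z (f p)) + g' (f p) (Y (f p)) (cov0 ?Z p x)"
    using L.compatible_along[OF sY sZ assms(2)] by (simp add: Y0 Z0 assms(9,10))
  finally have 3: "g p (nabla X0 Y0 p) z + g p y (nabla X0 Z0 p) =
      g' (f p) (cov0 ?Y p x) (Z (f p)) + g' (f p) (Y (f p)) (cov0 ?Z p x)"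
    using M.compatible[OF X0(1) Y0(1) Z0(1) assms(1)] by (simp add: X0 Y0 Z0)
  have 4: "g p y (nabla X0 Z0 p) = g p (nabla X0 Z0 p) y"
    by (rule M.g_sym[OF assms(1,3) TA[OF M.nabla_field[OF X0(1) Z0(1)]]])
  have 5: "g' (f p) (Y (f p)) (cov0 ?Z p x) = g' (f p) (cov0 ?Z p x) (Y (f p))"
    by (rule M'.g_sym[OF q T[OF assms(6)] C(2)])
  have 6: "g' (f p) (K X Z (f p)) (Y (f p)) = g' (f p) (K X Y (f p)) (Z (f p))"
    by (rule M'.K_symmetric[OF assms(5,7,6) q])
  show ?thesis using 1 2 3 4 5 6 by linarith
qed

lemma pf_inj:
  assumes "p \<in> carrier_of A" "u \<in> tangent_space A p" "v \<in> tangent_space A p" "pf p u = pf p v"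
  shows "u = v"
  using immersion_f assms
  unfolding statistical_immersion_def immersion_def by (meson inj_onD)

lemma decomposition:
  assumes "p \<in> carrier_of A" "\<xi> \<in> tangent_space B (f p)"
    and "g' (f p) \<xi> \<xi> = 1" "\<And>u. u \<in> tangent_space A p \<Longrightarrow> g' (f p) \<xi> (pf p u) = 0"
    and "y \<in> tangent_space B (f p)"
  obtains w where "w \<in> tangent_space A p" "y = pf p w + tscale (g' (f p) y \<xi>) \<xi>"
proof -
  note q = S.f_carrier[OF assms(1)]
  obtain c where c: "c \<in> A" "p \<in> dom_chart c" using assms(1) by (rule M.carrierE)
  obtain d where d: "d \<in> B" "f p \<in> dom_chart d" using q by (rule M'.carrierE)
  define L where "L a = pf p (tvec_of A c p a) d" for a
  note tv = M.tvec_of_tangent[OF c]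
  note pft = S.pushforward_tangent[OF assms(1)]
  have lin: "linear L"
    by (rule linearI) (simp_all add: L_def M.tvec_of_linear[OF c] S.pushforward_add[OF assms(1) tv tv]
        S.pushforward_scale[OF assms(1) tv])
  have inj: "inj L"
  proof (rule injI)
    fix a b assume "L a = L b"
    then have "pf p (tvec_of A c p a) = pf p (tvec_of A c p b)"
      unfolding L_def by (rule M'.tangent_eqI[OF pft[OF tv] pft[OF tv] d])
    from pf_inj[OF assms(1) tv tv this] have "tvec_of A c p a c = tvec_of A c p b c" by simp
    then show "a = b" using c by simp
  qed
  have "\<xi> d \<notin> range L"
  proof
    assume "\<xi> d \<in> range L"
    then obtain a where "\<xi> d = pf p (tvec_of A c p a) d" by (auto simp: L_def)
    from M'.tangent_eqI[OF assms(2) pft[OF tv] d this] assms(4)[OF tv[of a]] assms(3)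
    show False by simp
  qed
  then obtain a t where at: "y d = L a + t *\<^sub>R \<xi> d"
    by (rule range_hyperplane_complement[OF lin inj codim])
  define w where "w = tvec_of A c p a"
  have w: "w \<in> tangent_space A p" unfolding w_def by (rule tv)
  have y: "y = pf p w + tscale t \<xi>"
    by (rule M'.tangent_eqI[OF assms(5) _ d])
      (simp_all add: M'.tangent_add M'.tangent_scale pft tv assms(2) at L_def w_def)
  have "g' (f p) (pf p w) \<xi> = 0"
    using assms(4)[OF w] M'.g_sym[OF q assms(2) pft[OF w]] by simp
  then have "g' (f p) y \<xi> = t"
    unfolding y by (simp add: M'.g_add_left q pft w M'.tangent_scale assms(2,3) M'.g_scale_left)
  with y that[OF w] show thesis by simp
qed

text \<open>By the vanishing of the cubic form on tangential vectors, \<open>K X Y\<close> has no tangential part.\<close>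

lemma K_ext_normal:
  assumes "p \<in> carrier_of A" "\<xi> \<in> tangent_space B (f p)"
    and "g' (f p) \<xi> \<xi> = 1" "\<And>u. u \<in> tangent_space A p \<Longrightarrow> g' (f p) \<xi> (pf p u) = 0"
    and "x \<in> tangent_space A p" "y \<in> tangent_space A p"
    and "vector_field B X" "vector_field B Y" "X (f p) = pf p x" "Y (f p) = pf p y"
  obtains t where "K X Y (f p) = tscale t \<xi>"
proof -
  note q = S.f_carrier[OF assms(1)]
  note pft = S.pushforward_tangent[OF assms(1)]
  have KT: "K X Y (f p) \<in> tangent_space B (f p)"
    by (rule M'.vector_field_tangent[OF M'.K_field[OF assms(7,8)]])
  obtain w where w: "w \<in> tangent_space A p"
    "K X Y (f p) = pf p w + tscale (g' (f p) (K X Y (f p)) \<xi>) \<xi>"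
    by (rule decomposition[OF assms(1-4) KT])
  define t where "t = g' (f p) (K X Y (f p)) \<xi>"
  have eq: "K X Y (f p) = pf p w + tscale t \<xi>" unfolding t_def by (rule w(2))
  obtain W where W: "vector_field B W" "W (f p) = pf p w"
    by (rule M'.vector_field_extending[OF pft[OF w(1)]])
  have "0 = g' (f p) (pf p w + tscale t \<xi>) (pf p w)"
    using K_tangential[OF assms(1,5,6) w(1) assms(7,8) W(1) assms(9,10) W(2)] eq W(2) by simp
  also have "\<dots> = g' (f p) (pf p w) (pf p w)"
    by (simp add: M'.g_add_left q pft w(1) M'.tangent_scale assms(2) M'.g_scale_left assms(4))
  finally have "pf p w = 0"
    using M'.g_eq_0_imp[OF q pft[OF w(1)]] by simp
  with eq that show thesis by simp
qed

text \<open>The algebraic core. Write \<open>\<tau>(v)\<close> for \<open>g'(K\<^sub>v \<xi>, \<xi>)\<close>, suppose \<open>\<tau>(x) \<noteq> 0\<close> and choose a tangential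
  \<open>y \<noteq> 0\<close> with \<open>\<tau>(y) = 0\<close>, which exists since \<open>M\<close> has dimension at least \<open>2\<close>. For tangential
  \<open>z\<close> the vectors \<open>K\<^sub>y z\<close> and \<open>K\<^sub>x z\<close> are multiples of \<open>\<xi>\<close>, and the normal component of the commutator
  identity for \<open>x, y, z\<close> gives \<open>K\<^sub>y z = 0\<close>. Its tangential components then give
  \<open>g'(y, y) g'(x, x) = g'(x, y)\<^sup>2\<close>, because \<open>k0' \<noteq> k'\<close>. This is the equality case of the
  Cauchy-Schwarz inequality, so \<open>x\<close> is a multiple of \<open>y\<close>, contradicting \<open>\<tau>(x) \<noteq> 0\<close>.\<close>

lemma normal_cubic_form_0:
  assumes "p \<in> carrier_of A" "\<xi> \<in> tangent_space B (f p)"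
    and "g' (f p) \<xi> \<xi> = 1" "\<And>u. u \<in> tangent_space A p \<Longrightarrow> g' (f p) \<xi> (pf p u) = 0"
    and "constant_curvature B nabla' g' k'" "constant_curvature B nabla0' g' k0'" "k0' \<noteq> k'"
    and "DIM('e) \<ge> 2"
    and "x \<in> tangent_space A p" "vector_field B X" "X (f p) = pf p x" "vector_field B \<Xi>" "\<Xi> (f p) = \<xi>"
  shows "g' (f p) (K X \<Xi> (f p)) \<xi> = 0"
proof (rule ccontr)
  assume nz: "g' (f p) (K X \<Xi> (f p)) \<xi> \<noteq> 0"
  let ?q = "f p"
  note q = S.f_carrier[OF assms(1)]
  note pft = S.pushforward_tangent[OF assms(1)]
  note T = M'.vector_field_tangent
  note com = M'.K_commutator[OF assms(5,6) _ _ _ _ q]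
  \<comment> \<open>Total symmetry makes \<open>\<tau>\<close> the inner product with the vector \<open>\<zeta>\<close>, so \<open>\<tau>\<close> is linear.\<close>
  define \<zeta> where "\<zeta> = K \<Xi> \<Xi> ?q"
  have \<zeta>: "\<zeta> \<in> tangent_space B ?q"
    unfolding \<zeta>_def by (rule T[OF M'.K_field[OF assms(12,12)]])
  have tau: "g' ?q (K V \<Xi> ?q) \<xi> = g' ?q (V ?q) \<zeta>" if "vector_field B V" for V
    using M'.K_symmetric[OF assms(12) that assms(12) q] M'.K_commute[OF that assms(12)]
      M'.g_sym[OF q \<zeta> T[OF that]]
    by (simp add: \<zeta>_def assms(13))
  obtain c where c: "c \<in> A" "p \<in> dom_chart c" using assms(1) by (rule M.carrierE)
  note tv = M.tvec_of_tangent[OF c]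
  have "linear (\<lambda>a. g' ?q (pf p (tvec_of A c p a)) \<zeta>)"
    by (rule linearI) (simp_all add: M.tvec_of_linear[OF c] S.pushforward_add[OF assms(1) tv tv]
        S.pushforward_scale[OF assms(1) tv] M'.g_add_left[OF q pft[OF tv] pft[OF tv] \<zeta>]
        M'.g_scale_left[OF q pft[OF tv] \<zeta>])
  then obtain b where b: "b \<noteq> 0" "g' ?q (pf p (tvec_of A c p b)) \<zeta> = 0"
    using assms(8) by (rule nontrivial_kernel)
  define y where "y = tvec_of A c p b"
  have y: "y \<in> tangent_space A p" unfolding y_def by (rule tv)
  have "y c = b" unfolding y_def using c by simp
  then have "y \<noteq> 0" using b(1) by auto
  obtain Y where Y: "vector_field B Y" "Y ?q = pf p y"
    by (rule M'.vector_field_extending[OF pft[OF y]])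
  have tau_y: "g' ?q (K Y \<Xi> ?q) \<xi> = 0"
    using b(2) by (simp add: tau Y y_def)
  have gn: "g' ?q (V ?q) \<xi> = 0" if "V ?q = pf p v" "v \<in> tangent_space A p" for V v
    using assms(4)[OF that(2)] M'.g_sym[OF q assms(2) pft[OF that(2)]] that(1) by simp
  have KY: "K Y Z ?q = 0" if Z: "z \<in> tangent_space A p" "vector_field B Z" "Z ?q = pf p z" for Z z
  proof -
    obtain s where s: "K Y Z ?q = tscale s \<xi>"
      by (rule K_ext_normal[OF assms(1-4) y Z(1) Y(1) Z(2) Y(2) Z(3)])
    obtain t where t: "K X Z ?q = tscale t \<xi>"
      by (rule K_ext_normal[OF assms(1-4) assms(9) Z(1) assms(10) Z(2) assms(11) Z(3)])
    have "g' ?q (K Y Z ?q) (K X \<Xi> ?q) - g' ?q (K X Z ?q) (K Y \<Xi> ?q) = 0"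
      using com[OF assms(10) Y(1) Z(2) assms(12)] gn[of X x, OF assms(11,9)] gn[of Y y, OF Y(2) y]
      by (simp add: assms(13))
    moreover have "g' ?q (tscale a \<xi>) (K V \<Xi> ?q) = a * g' ?q (K V \<Xi> ?q) \<xi>"
      if "vector_field B V" for a V
      using M'.g_scale_left[OF q assms(2) T[OF M'.K_field[OF that assms(12)]]]
        M'.g_sym[OF q assms(2) T[OF M'.K_field[OF that assms(12)]]] by simp
    ultimately have "s * g' ?q (K X \<Xi> ?q) \<xi> = 0"
      using s t tau_y by (simp add: assms(10) Y(1))
    with nz have "s = 0" by simp
    with s show ?thesis by (simp add: fun_eq_iff)
  qed
  have KT: "K X Z ?q \<in> tangent_space B ?q" if "vector_field B Z" for Z
    by (rule T[OF M'.K_field[OF assms(10) that]])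
  let ?xx = "g' ?q (pf p x) (pf p x)" and ?xy = "g' ?q (pf p x) (pf p y)"
    and ?yy = "g' ?q (pf p y) (pf p y)"
  have "(k' - k0') * (?yy * ?xx - ?xy * g' ?q (pf p y) (pf p x)) = 0"
    using com[OF assms(10) Y(1) Y(1) assms(10)] KY[OF y Y] KY[OF assms(9,10,11)]
    by (simp add: Y(2) assms(11) M'.g_0_left M'.g_0_right q KT Y(1) assms(10))
  moreover have yx: "g' ?q (pf p y) (pf p x) = ?xy"
    by (rule M'.g_sym[OF q pft[OF y] pft[OF assms(9)]])
  ultimately have cs: "?yy * ?xx = ?xy * ?xy" using assms(7) by simp
  \<comment> \<open>A multiple of the component of \<open>x\<close> orthogonal to \<open>y\<close>; its norm vanishes by \<open>cs\<close>.\<close>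
  define w where "w = tscale ?yy (pf p x) + tscale (- ?xy) (pf p y)"
  have w: "w \<in> tangent_space B ?q"
    unfolding w_def by (intro M'.tangent_add M'.tangent_scale pft assms(9) y)
  have gw: "g' ?q w u = ?yy * g' ?q (pf p x) u - ?xy * g' ?q (pf p y) u"
    if "u \<in> tangent_space B ?q" for u
    using that unfolding w_def
    by (simp add: M'.g_add_left M'.g_scale_left q pft y assms(9) M'.tangent_scale)
  have "g' ?q w w = ?yy * g' ?q w (pf p x) - ?xy * g' ?q w (pf p y)"
    using gw[OF w] M'.g_sym[OF q w pft[OF y]] M'.g_sym[OF q w pft[OF assms(9)]] by simp
  also have "\<dots> = 0"
    using cs yx by (simp add: gw pft y assms(9)) 
  finally have "w = 0" by (rule M'.g_eq_0_imp[OF q w])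
  then have "?yy * g' ?q (pf p x) \<zeta> = 0"
    using gw[OF \<zeta>] b(2) M'.g_0_left[OF q \<zeta>] by (simp add: y_def)
  moreover have "g' ?q (pf p x) \<zeta> \<noteq> 0"
    using nz tau[OF assms(10)] assms(11) by simp
  ultimately have "pf p y = 0" using M'.g_eq_0_imp[OF q pft[OF y]] by simp
  also have "0 = pf p 0"
    using S.pushforward_add[OF assms(1) M.tangent_0 M.tangent_0] by simp
  finally have "y = 0" by (rule pf_inj[OF assms(1) y M.tangent_0])
  with \<open>y \<noteq> 0\<close> show False by simp
qed

text \<open>Because \<open>\<xi>\<close> has constant length, its covariant derivative for the Levi-Civita connection is
  tangential. So the normal component of the covariant derivative for \<open>nabla'\<close> comes from \<open>K\<close> alone.\<close>

lemma tau_star_eq: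
  assumes "open U" "U \<subseteq> carrier_of A" "unit_normal_on A B g' f U \<xi>" "p \<in> U" "v \<in> tangent_space A p"
    and "vector_field B X" "X (f p) = pf p v" "vector_field B \<Xi>" "\<Xi> (f p) = \<xi> p"
  shows "tau_star A B nabla' f \<xi> p v = g' (f p) (K X \<Xi> (f p)) (\<xi> p)"
proof -
  let ?q = "f p"
  have p: "p \<in> carrier_of A" using assms(2,4) by blast
  note q = S.f_carrier[OF p] and pft = S.pushforward_tangent[OF p]
  have sec: "section_along A B f U \<xi>"
    and unit: "\<And>r. r \<in> U \<Longrightarrow> g' (f r) (\<xi> r) (\<xi> r) = 1"
    and normal: "\<And>u. u \<in> tangent_space A p \<Longrightarrow> g' ?q (\<xi> p) (pf p u) = 0"
    using assms(3,4) unfolding unit_normal_on_def by blast+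
  note ds = S.diff_section_along[OF sec assms(1,2,4)]
  note \<xi> = S.diff_sectionD(2)[OF ds]
  note C0 = L.cov_along_tangent[OF ds assms(5)] and C = S.cov_along_tangent[OF ds assms(5)]
  have "dirderiv A (\<lambda>r. g' (f r) (\<xi> r) (\<xi> r)) p v = 0"
    using M.has_dirderiv_dirderiv[OF M.has_dirderiv_cong[OF p assms(1,4) unit[symmetric]
          M.has_dirderiv_const[OF p]] assms(5)] .
  then have "g' ?q (cov0 \<xi> p v) (\<xi> p) = 0"
    using L.compatible_along[OF ds ds assms(5)] M'.g_sym[OF q \<xi> C0] by simp
  then have eq: "g' ?q (cov \<xi> p v) (\<xi> p) = g' ?q (K X \<Xi> ?q) (\<xi> p)"
    using M'.g_add_left[OF q C0 M'.vector_field_tangent[OF M'.K_field[OF assms(6,8)]] \<xi>]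
    by (simp add: cov_difference[OF ds assms(5,6,7,8,9)])
  obtain w where w: "w \<in> tangent_space A p"
    "cov \<xi> p v = pf p w + tscale (g' ?q (cov \<xi> p v) (\<xi> p)) (\<xi> p)"
    by (rule decomposition[OF p \<xi> unit[OF assms(4)] normal C])
  show ?thesis
    unfolding tau_star_def eq[symmetric]
  proof (rule the_equality)
    have "- pf p (- w) = pf p w"
      using S.pushforward_scale[OF p w(1), of "- 1"]
      by (simp add: uminus_tscale[symmetric])
    then show "\<exists>w\<in>tangent_space A p.
        cov \<xi> p v = - pf p w + tscale (g' ?q (cov \<xi> p v) (\<xi> p)) (\<xi> p)"
      using w M.tangent_uminus[OF w(1)] by metis
  next
    fix t assume "\<exists>w\<in>tangent_space A p. cov \<xi> p v = - pf p w + tscale t (\<xi> p)"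
    then obtain u where u: "u \<in> tangent_space A p" "cov \<xi> p v = - pf p u + tscale t (\<xi> p)" by blast
    have "g' ?q (pf p u) (\<xi> p) = 0"
      using normal[OF u(1)] M'.g_sym[OF q \<xi> pft[OF u(1)]] by simp
    then show "t = g' ?q (cov \<xi> p v) (\<xi> p)"
      unfolding u(2)
      by (simp add: M'.g_diff_left M'.g_scale_left M'.tangent_scale q pft u(1) \<xi> unit[OF assms(4)])
  qed
qed

end

theorem theorem4p1:
  fixes A :: "('m::{t2_space, second_countable_topology}, 'e::euclidean_space) chart set"
    and nabla :: "('m, 'e) connection" and g :: "('m, 'e) metric"
    and B :: "('n::{t2_space, second_countable_topology}, 'f::euclidean_space) chart set"
    and nabla' nabla0' :: "('n, 'f) connection" and g' :: "('n, 'f) metric"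
    and f :: "'m \<Rightarrow> 'n"
    and k k' k0' :: real
  assumes "trivial_statistical_manifold A nabla g"
    and "constant_curvature A nabla g k"
    and "statistical_manifold B nabla' g'"
    and "constant_curvature B nabla' g' k'"
    and "levi_civita B nabla0' g'"
    and "constant_curvature B nabla0' g' k0'"
    and "k0' \<noteq> k'"
    and "statistical_immersion A nabla g B nabla' g' f"
    and "DIM('f) = DIM('e) + 1"
    and "DIM('e) \<ge> 2"
  shows "equiaffine A B nabla' g' f"
proof -
  interpret hypersurface A nabla g B nabla' nabla0' g' f
    by unfold_locales (fact assms)+
  show ?thesis
    unfolding equiaffine_def
  proof (intro allI impI ballI)
    fix U \<xi> p v
    assume U: "open U" "U \<subseteq> carrier_of A" "unit_normal_on A B g' f U \<xi>" "p \<in> U"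
      and v: "v \<in> tangent_space A p"
    have p: "p \<in> carrier_of A" using U by blast
    have \<xi>: "\<xi> p \<in> tangent_space B (f p)" "g' (f p) (\<xi> p) (\<xi> p) = 1"
      "\<And>u. u \<in> tangent_space A p \<Longrightarrow> g' (f p) (\<xi> p) (pf p u) = 0"
      using U(3,4) unfolding unit_normal_on_def section_along_def by blast+
    obtain X where X: "vector_field B X" "X (f p) = pf p v"
      by (rule M'.vector_field_extending[OF S.pushforward_tangent[OF p v]])
    obtain \<Xi> where \<Xi>: "vector_field B \<Xi>" "\<Xi> (f p) = \<xi> p"
      by (rule M'.vector_field_extending[OF \<xi>(1)])
    show "tau_star A B nabla' f \<xi> p v = 0"
      unfolding tau_star_eq[OF U v X \<Xi>]
      by (rule normal_cubic_form_0[OF p \<xi> assms(4,6,7,10) v X \<Xi>])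
  qed
qed

end
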